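(* Let $\mathbf{V}$ be a variety of algebras. If the diagram $\mathcal{D}_{\bowtie}$ admits a lifting, with respect to the congruence lattice functor, by algebras and homomorphisms in $\mathbf{V}$, then there exists an algebra $U$ in $\mathbf{V}$ such that $M_3$ has a $0,1$-lattice embedding into $\operatorname{Con} U$. Furthermore, $\mathbf{V}$ satisfies no nontrivial congruence lattice identity.
   Context: Put $n=\{0,1,\dots,n-1\}$ for every natural number $n$, and let $\mathfrak{P}(X)$ denote the powerset of $X$, viewed as a $\langle\vee,0,1\rangle$-semilattice (join is union, $0=\varnothing$, $1=X$). **The diagram $\mathcal{D}_{\bowtie}$.** Define $\langle\vee,0,1\rangle$-homomorphisms $e\colon\mathfrak{P}(1)\to\mathfrak{P}(2)$, $f_i\colon\mathfrak{P}(2)\to\mathfrak{P}(3)$, $u_i\colon\mathfrak{P}(3)\to\mathfrak{P}(4)$ ($i<3$) by their values on atoms: - $e$: $\{0\}\mapsto\{0,1\}$. - $f_0$: $\{0\}\mapsto\{0,1\}$, $\{1\}\mapsto\{0,2\}$. - $f_1$: $\{0\}\mapsto\{0,1\}$, $\{1\}\mapsto\{1,2\}$. - $f_2$: $\{0\}\mapsto\{0,2\}$, $\{1\}\mapsto\{1,2\}$. - $u_0$: $\{0\}\mapsto\{0\}$, $\{1\}\mapsto\{1,3\}$, $\{2\}\mapsto\{2,3\}$. - $u_1$: $\{0\}\mapsto\{0,3\}$, $\{1\}\mapsto\{1\}$, $\{2\}\mapsto\{2,3\}$. - $u_2$: $\{0\}\mapsto\{0,3\}$, $\{1\}\mapsto\{1,3\}$,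 $\{2\}\mapsto\{2\}$. The index poset has eight elements: a least element $a$, elements $a_0,a_1,a_2$, elements $b_0,b_1,b_2$, and a greatest element $b$, with $a<a_i<b_j<b$ for all $i,j<3$ (the $a_i$ pairwise incomparable, the $b_j$ pairwise incomparable). The diagram $\mathcal{D}_{\bowtie}$ assigns $\mathfrak{P}(1)$ to $a$, $\mathfrak{P}(2)$ to each $a_i$, $\mathfrak{P}(3)$ to each $b_j$, $\mathfrak{P}(4)$ to $b$; the arrow $a\to a_i$ is $e$ for each $i$, the arrow $a_i\to b_j$ is $f_i$ for all $i,j$, and the arrow $b_j\to b$ is $u_j$. This diagram commutes, and all its arrows are $\langle\vee,0,1\rangle$-embeddings. **Congruence lattice functor and liftings.** For an algebra $A$, $\operatorname{Con}A$ is its congruence lattice. For a homomorphism $f\colon A\to B$ of algebras of the same similarity type, $\operatorname{Con}f\colon\operatorname{Con}A\to\operatorname{Con}B$ sends a congruence $\alpha$ to the congruence of $B$ generated by all pairs $\langle f(x),f(y)\rangle$ with $\langle x,y\rangle\in\alpha$. This defines a functor $\operatorname{Con}$ from algebras of a given similarity type to the category of algebraic lattices with compactness-preserving complete join-homomorphisms. A finite $\langle\vee,0\rangle$-semilattice is regarded as a (finite) algebraic lattice. A lifting of a diagram $\Phi$ (a functor from the index poset, viewed as a category, to algebraic lattices) by algebras and homomorphisms in $\mathbf{V}$ is a functor $\Psi$ from the same index poset to $\mathbf{V}$ (with homomorphisms) such that $\operatorname{Con}\Psi$ and $\Phi$ are naturally equivalent. **Other notions.** $M_3$ is the five-element modular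 nondistributive lattice (least element, greatest element, three pairwise incomparable atoms). A $0,1$-lattice embedding is an injective lattice homomorphism preserving least and greatest elements. A variety $\mathbf{V}$ satisfies no nontrivial congruence lattice identity if every lattice identity that holds in the congruence lattices of all algebras in $\mathbf{V}$ holds in all lattices. *)

theory Defs
  imports "HOL-Algebra.Complete_Lattice"
begin

section \<open>Algebras, terms and varieties\<close>

text \<open>A similarity type is an arity function on the operation symbols. The operation belonging to a
  symbol is applied to argument lists; its values on lists of the wrong length, or on lists with
  entries outside the carrier, are irrelevant.\<close>

record ('f, 'a) algebra = "'a partial_object" +
  opn :: "'f \<Rightarrow> 'a list \<Rightarrow> 'a"

definition is_algebra :: "('f \<Rightarrow> nat) \<Rightarrow> ('f, 'a) algebra \<Rightarrow> bool" where
  "is_algebra ar A \<longleftrightarrow> carrier A \<noteq> {} \<and>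
     (\<forall>f xs. length xs = ar f \<and> set xs \<subseteq> carrier A \<longrightarrow> opn A f xs \<in> carrier A)"

definition algebra_hom ::
  "('f \<Rightarrow> nat) \<Rightarrow> ('f, 'a) algebra \<Rightarrow> ('f, 'b) algebra \<Rightarrow> ('a \<Rightarrow> 'b) \<Rightarrow> bool" where
  "algebra_hom ar A B h \<longleftrightarrow> h \<in> carrier A \<rightarrow> carrier B \<and>
     (\<forall>f xs. length xs = ar f \<and> set xs \<subseteq> carrier A \<longrightarrow> h (opn A f xs) = opn B f (map h xs))"

datatype ('f, 'v) tm = Var 'v | Op 'f "('f, 'v) tm list"

fun wf_tm :: "('f \<Rightarrow> nat) \<Rightarrow> ('f, 'v) tm \<Rightarrow> bool" where
  "wf_tm ar (Var x) = True"
| "wf_tm ar (Op f ts) = (length ts = ar f \<and> (\<forall>t \<in> set ts. wf_tm ar t))"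

fun eval_tm :: "('f, 'a) algebra \<Rightarrow> ('v \<Rightarrow> 'a) \<Rightarrow> ('f, 'v) tm \<Rightarrow> 'a" where
  "eval_tm A \<rho> (Var x) = \<rho> x"
| "eval_tm A \<rho> (Op f ts) = opn A f (map (eval_tm A \<rho>) ts)"

definition identities :: "('f \<Rightarrow> nat) \<Rightarrow> (('f, nat) tm \<times> ('f, nat) tm) set" where
  "identities ar = {(s, t). wf_tm ar s \<and> wf_tm ar t}"

definition satisfies :: "('f, 'a) algebra \<Rightarrow> ('f, nat) tm \<Rightarrow> ('f, nat) tm \<Rightarrow> bool" where
  "satisfies A s t \<longleftrightarrow> (\<forall>\<rho>. range \<rho> \<subseteq> carrier A \<longrightarrow> eval_tm A \<rho> s = eval_tm A \<rho> t)"

text \<open>A variety is an equational class, presented by a set \<open>E\<close> of identities; its members may have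
  carriers in any type, and the set below collects those with carrier in the type \<open>'a\<close>.\<close>

definition in_variety ::
  "('f \<Rightarrow> nat) \<Rightarrow> (('f, nat) tm \<times> ('f, nat) tm) set \<Rightarrow> ('f, 'a) algebra set" where
  "in_variety ar E = {A. is_algebra ar A \<and> (\<forall>(s, t) \<in> E. satisfies A s t)}"

section \<open>The congruence lattice functor\<close>

definition congruence :: "('f \<Rightarrow> nat) \<Rightarrow> ('f, 'a) algebra \<Rightarrow> ('a \<times> 'a) set \<Rightarrow> bool" where
  "congruence ar A \<theta> \<longleftrightarrow> equiv (carrier A) \<theta> \<and>
     (\<forall>f xs ys. length xs = ar f \<and> list_all2 (\<lambda>x y. (x, y) \<in> \<theta>) xs ys
        \<longrightarrow> (opn A f xs, opn A f ys) \<in> \<theta>)"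

definition Con :: "('f \<Rightarrow> nat) \<Rightarrow> ('f, 'a) algebra \<Rightarrow> ('a \<times> 'a) set gorder" where
  "Con ar A = \<lparr>carrier = {\<theta>. congruence ar A \<theta>}, eq = (=), le = (\<subseteq>)\<rparr>"

definition cong_generated ::
  "('f \<Rightarrow> nat) \<Rightarrow> ('f, 'a) algebra \<Rightarrow> ('a \<times> 'a) set \<Rightarrow> ('a \<times> 'a) set" where
  "cong_generated ar A R = \<Inter>{\<theta>. congruence ar A \<theta> \<and> R \<subseteq> \<theta>}"

text \<open>The source algebra is not an argument of \<open>Con_map\<close>, being determined by the congruence \<open>\<alpha>\<close>.\<close>

definition Con_map ::
  "('f \<Rightarrow> nat) \<Rightarrow> ('f, 'b) algebra \<Rightarrow> ('a \<Rightarrow> 'b) \<Rightarrow> ('a \<times> 'a) set \<Rightarrow> ('b \<times> 'b) set" where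
  "Con_map ar B h \<alpha> = cong_generated ar B {(h x, h y) | x y. (x, y) \<in> \<alpha>}"

lemma congruence_Inter:
  assumes "S \<noteq> {}" "\<And>\<theta>. \<theta> \<in> S \<Longrightarrow> congruence ar A \<theta>"
  shows "congruence ar A (\<Inter>S)"
proof -
  have e: "\<And>\<theta>. \<theta> \<in> S \<Longrightarrow> equiv (carrier A) \<theta>"
    using assms(2) by (simp add: congruence_def)
  have "equiv (carrier A) (\<Inter>S)"
  proof (rule equivI)
    show "\<Inter>S \<subseteq> carrier A \<times> carrier A"
      using assms(1) e by (auto simp: equiv_def)
    show "refl_on (carrier A) (\<Inter>S)"
      using e by (auto simp: equiv_def refl_on_def)
    show "sym (\<Inter>S)" using e by (auto simp: equiv_def sym_def)
    show "trans (\<Inter>S)"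
    proof (intro transI InterI)
      fix x y z \<theta> assume "(x, y) \<in> \<Inter>S" "(y, z) \<in> \<Inter>S" and t: "\<theta> \<in> S"
      then have "(x, y) \<in> \<theta>" "(y, z) \<in> \<theta>" by auto
      moreover have "trans \<theta>" using e[OF t] by (simp add: equiv_def)
      ultimately show "(x, z) \<in> \<theta>" by (rule transD[rotated])
    qed
  qed
  moreover have "(opn A f xs, opn A f ys) \<in> \<Inter>S"
    if "length xs = ar f" "list_all2 (\<lambda>x y. (x, y) \<in> \<Inter>S) xs ys" for f xs ys
  proof
    fix \<theta> assume t: "\<theta> \<in> S"
    have "list_all2 (\<lambda>x y. (x, y) \<in> \<theta>) xs ys"
      by (rule list.rel_mono_strong[OF that(2)]) (use t in auto)
    then show "(opn A f xs, opn A f ys) \<in> \<theta>"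
      using assms(2)[OF t] that(1) by (simp add: congruence_def)
  qed
  ultimately show ?thesis by (simp add: congruence_def)
qed

lemma congruence_full:
  assumes "is_algebra ar A"
  shows "congruence ar A (carrier A \<times> carrier A)"
proof -
  have "equiv (carrier A) (carrier A \<times> carrier A)"
    by (auto simp: equiv_def refl_on_def sym_def trans_def)
  moreover have "(opn A f xs, opn A f ys) \<in> carrier A \<times> carrier A"
    if l: "length xs = ar f" and r: "list_all2 (\<lambda>x y. (x, y) \<in> carrier A \<times> carrier A) xs ys"
    for f xs ys
  proof -
    have "set xs \<subseteq> carrier A \<and> set ys \<subseteq> carrier A"
      using r by (induction rule: list_all2_induct) auto
    moreover have "length ys = ar f" using l list_all2_lengthD[OF r] by simp
    ultimately show ?thesis using assms l by (simp add: is_algebra_def)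
  qed
  ultimately show ?thesis unfolding congruence_def by blast
qed

lemma complete_lattice_Con:
  assumes "is_algebra ar A"
  shows "complete_lattice (Con ar A)"
proof -
  interpret po: partial_order "Con ar A"
    by unfold_locales (auto simp: Con_def)
  show ?thesis
  proof (rule po.complete_lattice_criterion1)
    show "\<exists>g. greatest (Con ar A) g (carrier (Con ar A))"
      by (rule exI[of _ "carrier A \<times> carrier A"])
         (use congruence_full[OF assms] in
           \<open>auto simp: greatest_def Con_def congruence_def equiv_def\<close>)
    fix S assume S: "S \<subseteq> carrier (Con ar A)" "S \<noteq> {}"
    have "congruence ar A (\<Inter>S)"
      by (rule congruence_Inter) (use S in \<open>auto simp: Con_def\<close>)
    then show "\<exists>i. greatest (Con ar A) i (Lower (Con ar A) S)"
      by (intro exI[of _ "\<Inter>S"]) (use S in \<open>auto simp: greatest_def Lower_def Con_def\<close>)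
  qed
qed

section \<open>Algebraic lattices, diagrams and liftings\<close>

definition compact_elem :: "'a gorder \<Rightarrow> 'a \<Rightarrow> bool" where
  "compact_elem L c \<longleftrightarrow> c \<in> carrier L \<and>
     (\<forall>S \<subseteq> carrier L. c \<sqsubseteq>\<^bsub>L\<^esub> \<Squnion>\<^bsub>L\<^esub>S \<longrightarrow> (\<exists>F \<subseteq> S. finite F \<and> c \<sqsubseteq>\<^bsub>L\<^esub> \<Squnion>\<^bsub>L\<^esub>F))"

text \<open>Morphisms and isomorphisms of the category of algebraic lattices with compactness-preserving
  complete join-homomorphisms.\<close>

definition alg_lat_hom :: "'a gorder \<Rightarrow> 'b gorder \<Rightarrow> ('a \<Rightarrow> 'b) \<Rightarrow> bool" where
  "alg_lat_hom L M h \<longleftrightarrow> h \<in> carrier L \<rightarrow> carrier M \<and> sup_pres L M h \<and>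
     (\<forall>c. compact_elem L c \<longrightarrow> compact_elem M (h c))"

definition alg_lat_iso :: "'a gorder \<Rightarrow> 'b gorder \<Rightarrow> ('a \<Rightarrow> 'b) \<Rightarrow> bool" where
  "alg_lat_iso L M h \<longleftrightarrow> alg_lat_hom L M h \<and>
     (\<exists>g. alg_lat_hom M L g \<and> (\<forall>x \<in> carrier L. g (h x) = x) \<and> (\<forall>y \<in> carrier M. h (g y) = y))"

text \<open>Functors from the poset \<open>'i\<close> to the variety presented by \<open>E\<close>; \<open>Arr p q\<close> is meaningful for
  \<open>p \<le> q\<close> only.\<close>

definition variety_diagram ::
  "('f \<Rightarrow> nat) \<Rightarrow> (('f, nat) tm \<times> ('f, nat) tm) set
     \<Rightarrow> ('i::order \<Rightarrow> ('f, 'a) algebra) \<Rightarrow> ('i \<Rightarrow> 'i \<Rightarrow> 'a \<Rightarrow> 'a) \<Rightarrow> bool" where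
  "variety_diagram ar E Ob Arr \<longleftrightarrow>
     (\<forall>p. Ob p \<in> in_variety ar E) \<and>
     (\<forall>p q. p \<le> q \<longrightarrow> algebra_hom ar (Ob p) (Ob q) (Arr p q)) \<and>
     (\<forall>p. \<forall>x \<in> carrier (Ob p). Arr p p x = x) \<and>
     (\<forall>p q r. p \<le> q \<and> q \<le> r \<longrightarrow> (\<forall>x \<in> carrier (Ob p). Arr p r x = Arr q r (Arr p q x)))"

definition con_naturally_equivalent ::
  "('f \<Rightarrow> nat) \<Rightarrow> ('i::order \<Rightarrow> ('f, 'a) algebra) \<Rightarrow> ('i \<Rightarrow> 'i \<Rightarrow> 'a \<Rightarrow> 'a)
     \<Rightarrow> ('i \<Rightarrow> 'b gorder) \<Rightarrow> ('i \<Rightarrow> 'i \<Rightarrow> 'b \<Rightarrow> 'b) \<Rightarrow> bool" where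
  "con_naturally_equivalent ar Ob Arr DOb DArr \<longleftrightarrow>
     (\<exists>\<eta>. (\<forall>p. alg_lat_iso (Con ar (Ob p)) (DOb p) (\<eta> p)) \<and>
       (\<forall>p q. p \<le> q \<longrightarrow> (\<forall>\<alpha> \<in> carrier (Con ar (Ob p)).
          \<eta> q (Con_map ar (Ob q) (Arr p q) \<alpha>) = DArr p q (\<eta> p \<alpha>))))"

definition is_lifting ::
  "('f \<Rightarrow> nat) \<Rightarrow> (('f, nat) tm \<times> ('f, nat) tm) set
     \<Rightarrow> ('i::order \<Rightarrow> ('f, 'a) algebra) \<Rightarrow> ('i \<Rightarrow> 'i \<Rightarrow> 'a \<Rightarrow> 'a)
     \<Rightarrow> ('i \<Rightarrow> 'b gorder) \<Rightarrow> ('i \<Rightarrow> 'i \<Rightarrow> 'b \<Rightarrow> 'b) \<Rightarrow> bool" where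
  "is_lifting ar E Ob Arr DOb DArr \<longleftrightarrow>
     variety_diagram ar E Ob Arr \<and> con_naturally_equivalent ar Ob Arr DOb DArr"

section \<open>The bowtie diagram\<close>

datatype three = I0 | I1 | I2

datatype bowtie = Bt_a | Bt_ai three | Bt_bj three | Bt_b

fun bt_level :: "bowtie \<Rightarrow> nat" where
  "bt_level Bt_a = 0"
| "bt_level (Bt_ai i) = 1"
| "bt_level (Bt_bj j) = 2"
| "bt_level Bt_b = 3"

instantiation bowtie :: order
begin

definition less_bowtie :: "bowtie \<Rightarrow> bowtie \<Rightarrow> bool" where
  "p < q \<longleftrightarrow> bt_level p < bt_level q"

definition less_eq_bowtie :: "bowtie \<Rightarrow> bowtie \<Rightarrow> bool" where
  "p \<le> q \<longleftrightarrow> p = q \<or> bt_level p < bt_level q"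

instance
  by standard (auto simp: less_bowtie_def less_eq_bowtie_def)

end

definition powerset_lattice :: "nat \<Rightarrow> nat set gorder" where
  "powerset_lattice n = \<lparr>carrier = Pow {..<n}, eq = (=), le = (\<subseteq>)\<rparr>"

text \<open>The join-homomorphism between finite powersets with prescribed values on the atoms.\<close>

definition from_atoms :: "(nat \<Rightarrow> nat set) \<Rightarrow> nat set \<Rightarrow> nat set" where
  "from_atoms g X = (\<Union>x \<in> X. g x)"

definition bt_e :: "nat set \<Rightarrow> nat set" where
  "bt_e = from_atoms (\<lambda>_. {0, 1})"

fun bt_f :: "three \<Rightarrow> nat set \<Rightarrow> nat set" where
  "bt_f I0 = from_atoms (\<lambda>x. if x = 0 then {0, 1} else {0, 2})"
| "bt_f I1 = from_atoms (\<lambda>x. if x = 0 then {0, 1} else {1, 2})"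
| "bt_f I2 = from_atoms (\<lambda>x. if x = 0 then {0, 2} else {1, 2})"

fun bt_u :: "three \<Rightarrow> nat set \<Rightarrow> nat set" where
  "bt_u I0 = from_atoms (\<lambda>x. if x = 0 then {0} else if x = 1 then {1, 3} else {2, 3})"
| "bt_u I1 = from_atoms (\<lambda>x. if x = 0 then {0, 3} else if x = 1 then {1} else {2, 3})"
| "bt_u I2 = from_atoms (\<lambda>x. if x = 0 then {0, 3} else if x = 1 then {1, 3} else {2})"

definition bowtie_ob :: "bowtie \<Rightarrow> nat set gorder" where
  "bowtie_ob p = powerset_lattice (Suc (bt_level p))"

text \<open>For the non-covering pairs one path is chosen; by \<open>bowtie_arr_comp\<close> below, all paths give the
  same map. The last equation covers the identities (and the pairs with \<open>\<not> p \<le> q\<close>, where the value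
  is irrelevant).\<close>

fun bowtie_arr :: "bowtie \<Rightarrow> bowtie \<Rightarrow> nat set \<Rightarrow> nat set" where
  "bowtie_arr Bt_a (Bt_ai i) = bt_e"
| "bowtie_arr (Bt_ai i) (Bt_bj j) = bt_f i"
| "bowtie_arr (Bt_bj j) Bt_b = bt_u j"
| "bowtie_arr Bt_a (Bt_bj j) = bt_f I0 \<circ> bt_e"
| "bowtie_arr (Bt_ai i) Bt_b = bt_u I0 \<circ> bt_f i"
| "bowtie_arr Bt_a Bt_b = bt_u I0 \<circ> bt_f I0 \<circ> bt_e"
| "bowtie_arr _ _ = id"

lemma bt_fe: "bt_f i (bt_e X) = bt_f I0 (bt_e X)"
  by (cases i) (auto simp: bt_e_def from_atoms_def)

lemma bt_uf: "bt_u j (bt_f i X) = bt_u I0 (bt_f i X)"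
proof -
  have comp: "from_atoms g (from_atoms h X) = from_atoms (\<lambda>x. from_atoms g (h x)) X" for g h
    by (simp add: from_atoms_def)
  have pair: "from_atoms g {x, y} = g x \<union> g y" for g x y
    by (simp add: from_atoms_def)
  show ?thesis
    by (cases j; cases i; simp only: bt_f.simps bt_u.simps comp if_distrib[where f = "from_atoms _"] pair)
       (rule arg_cong[where f = "\<lambda>g. from_atoms g X"], simp add: fun_eq_iff, blast)+
qed

lemma bowtie_arr_id: "bowtie_arr p p X = X"
  by (cases p) auto

lemma bowtie_arr_comp:
  assumes "p \<le> q" "q \<le> r"
  shows "bowtie_arr p r X = bowtie_arr q r (bowtie_arr p q X)"
  using assms
  by (cases p; cases q; cases r)
     (simp_all add: less_eq_bowtie_def del: bt_f.simps bt_u.simps,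
      (rule bt_fe[symmetric] bt_uf[symmetric] arg_cong[OF bt_fe[symmetric], where f = "bt_u I0"])+)


section \<open>The lattice \<open>M\<^sub>3\<close>, embeddings and lattice identities\<close>

datatype m3 = M3_bot | M3_atom three | M3_top

definition M3 :: "m3 gorder" where
  "M3 = \<lparr>carrier = UNIV, eq = (=), le = (\<lambda>x y. x = y \<or> x = M3_bot \<or> y = M3_top)\<rparr>"

definition zero_one_lattice_embedding :: "'a gorder \<Rightarrow> 'b gorder \<Rightarrow> ('a \<Rightarrow> 'b) \<Rightarrow> bool" where
  "zero_one_lattice_embedding L M h \<longleftrightarrow>
     h \<in> carrier L \<rightarrow> carrier M \<and> inj_on h (carrier L) \<and> join_pres L M h \<and> meet_pres L M h \<and>
     h \<bottom>\<^bsub>L\<^esub> = \<bottom>\<^bsub>M\<^esub> \<and> h \<top>\<^bsub>L\<^esub> = \<top>\<^bsub>M\<^esub>"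

datatype lat_tm = LVar nat | LJoin lat_tm lat_tm | LMeet lat_tm lat_tm

fun eval_lat :: "'a gorder \<Rightarrow> (nat \<Rightarrow> 'a) \<Rightarrow> lat_tm \<Rightarrow> 'a" where
  "eval_lat L \<rho> (LVar n) = \<rho> n"
| "eval_lat L \<rho> (LJoin p q) = eval_lat L \<rho> p \<squnion>\<^bsub>L\<^esub> eval_lat L \<rho> q"
| "eval_lat L \<rho> (LMeet p q) = eval_lat L \<rho> p \<sqinter>\<^bsub>L\<^esub> eval_lat L \<rho> q"

definition lattice_identity_holds :: "'a gorder \<Rightarrow> lat_tm \<Rightarrow> lat_tm \<Rightarrow> bool" where
  "lattice_identity_holds L p q \<longleftrightarrow>
     (\<forall>\<rho>. range \<rho> \<subseteq> carrier L \<longrightarrow> eval_lat L \<rho> p = eval_lat L \<rho> q)"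

text \<open>A variety is a proper class, so its members must be taken in some type. It is enough to
  consider carriers in \<open>('f, nat) tm set\<close>: every countably generated member is isomorphic to a quotient
  of the term algebra in countably many variables, whose elements are sets of terms, and a lattice
  identity that fails in \<open>Con A\<close> already fails in \<open>Con B\<close> for some countably generated subalgebra \<open>B\<close>
  of \<open>A\<close> (close under the countably many witnesses of the congruence joins involved).\<close>

definition congruence_identity_of ::
  "('f \<Rightarrow> nat) \<Rightarrow> (('f, nat) tm \<times> ('f, nat) tm) set \<Rightarrow> lat_tm \<Rightarrow> lat_tm \<Rightarrow> bool" where
  "congruence_identity_of ar E p q \<longleftrightarrow>
     (\<forall>A \<in> (in_variety ar E :: ('f, ('f, nat) tm set) algebra set).
        lattice_identity_holds (Con ar A) p q)"

end

theory Submission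
  imports Defs
begin

text \<open>Let \<open>B\<close> be the algebra that lifts the top vertex of the diagram, and let \<open>U\<close> be the subalgebra of
\<open>B\<close> generated by the images \<open>A\<^sub>0, A\<^sub>1, A\<^sub>2\<close> of the algebras that lift the vertices \<open>a\<^sub>i\<close>. Three of the four
coatoms of \<open>Con B\<close>, those that miss an atom \<open>k < 3\<close>, restrict to congruences \<open>\<gamma>\<^sub>0, \<gamma>\<^sub>1, \<gamma>\<^sub>2\<close> of \<open>U\<close>. They
generate a copy of \<open>M\<^sub>3\<close>:

\<^item> \<open>\<gamma>\<^sub>i \<inter> \<gamma>\<^sub>j\<close> is trivial (\<open>hull_cong_meet\<close>), because \<open>U\<close> lies in the image of each of the three algebras
  over the \<open>b\<^sub>l\<close>, and a congruence of \<open>B\<close> only matters on such an image through the part that comes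
  from \<open>\<PP>(3)\<close> along \<open>u\<^sub>l\<close>;
\<^item> the join of \<open>\<gamma>\<^sub>j\<close> and \<open>\<gamma>\<^sub>k\<close> is full (\<open>hull_cong_join\<close>), because for the third index \<open>i\<close> these two
  congruences cover the two atoms of \<open>Con A\<^sub>i\<close>, and the square of a single \<open>A\<^sub>i\<close> already generates the full
  congruence of \<open>U\<close> (\<open>hull_generates\<close>): it contains the image of the algebra over \<open>a\<close>, whose square
  generates the full congruence of every \<open>A\<^sub>m\<close>.

For the congruence identities \<open>M\<^sub>3\<close> alone is not enough, since vector spaces realise it too. The
further input is that \<open>A\<^sub>0\<close> is a proper subalgebra of \<open>U\<close> (\<open>mid_proper\<close>) although its square generates
the full congruence; this cannot happen in an affine algebra. The three \<open>\<gamma>\<^sub>k\<close> make \<open>U\<close> abelian in a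
weak sense (\<open>term_condition\<close>), so one may think of the operations of \<open>U\<close> as linear combinations
\<open>\<Sum> r\<^sub>i x\<^sub>i\<close>. Call the coordinate \<open>i\<close> of an operation cancellable if there is an operation that
behaves like \<open>x - r\<^sub>i a + r\<^sub>i b\<close>. A block of coordinates of an idempotent operation, with coefficient
the sum of the \<open>r\<^sub>i\<close>, is cancellable if and only if all its members are
(\<open>cancellable_union\<close>, \<open>cancellable_member\<close>). If the only coordinate of a projection were cancellable, then
\<open>x - a + b\<close> would be available, \<open>A\<^sub>0\<close> would be a union of classes of the full congruence, and \<open>A\<^sub>0 = U\<close>
would follow (\<open>proj_not_cancellable\<close>). Hence assigning to an idempotent term the set of its
non-cancellable variables commutes with renaming of variables and maps a variable to its singleton
(\<open>essential_vars_rename\<close>, \<open>essential_vars_Var\<close>): as far as equations without nesting can tell, the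
idempotent terms of the variety behave like semilattice words.

It is a theorem of Freese and Nation that congruence lattices of semilattices satisfy no nontrivial
lattice identity. A direct construction gives, for every inequality \<open>p \<le> q\<close> that fails in some
lattice, a finite semilattice \<open>(\<PP>(X), \<inter>)\<close> and congruences on it refuting the inequality
(\<open>points_in_family_eval\<close>, \<open>points_notin_family_eval\<close>, \<open>sep_strict\<close>). Label the variables of the free algebra
by the elements of the semilattice and generate congruences from the related pairs of variables. The
map that sends an idempotent term to the intersection of the labels of its essential variables then
carries the refutation to the free algebra (\<open>sep_represented\<close>), a member of the variety.\<close>

section \<open>Three equivalences that meet and join like the atoms of \<open>M\<^sub>3\<close>\<close>

text \<open>\<open>A0\<close> is a subset that the operations considered below are required to preserve; it plays the role of the
subalgebra that is later shown to be proper.\<close>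

locale m3_frame =
  fixes C :: "'a set" and g :: "three \<Rightarrow> ('a \<times> 'a) set" and A0 :: "'a set"
  assumes equiv_g: "equiv C (g k)"
    and meet_g: "i \<noteq> j \<Longrightarrow> g i \<inter> g j \<subseteq> Id"
    and join_g: "i \<noteq> j \<Longrightarrow> C \<times> C \<subseteq> (g i \<union> g j)\<^sup>*"
    and A0_sub: "A0 \<subseteq> C"
begin

lemma g_refl: "x \<in> C \<Longrightarrow> (x, x) \<in> g k"
  using equiv_g[of k] by (auto simp: equiv_def refl_on_def)

lemma g_sym: "(x, y) \<in> g k \<Longrightarrow> (y, x) \<in> g k"
  using equiv_g[of k] by (auto simp: equiv_def sym_def)

lemma g_trans: "(x, y) \<in> g k \<Longrightarrow> (y, z) \<in> g k \<Longrightarrow> (x, z) \<in> g k"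
  using equiv_g[of k] unfolding equiv_def trans_def by blast

lemma g_C: "(x, y) \<in> g k \<Longrightarrow> x \<in> C \<and> y \<in> C"
  using equiv_g[of k] by (auto simp: equiv_def)

text \<open>Operations are functions of valuations with an arbitrary index type, so that terms over any set of
variables are covered; finite support makes them finitary.\<close>

definition compatible :: "(('v \<Rightarrow> 'a) \<Rightarrow> 'a) \<Rightarrow> bool" where
  "compatible f \<longleftrightarrow>
     (\<exists>W. finite W \<and> (\<forall>\<rho> \<rho>'. (\<forall>n \<in> W. \<rho> n = \<rho>' n) \<longrightarrow> f \<rho> = f \<rho>')) \<and>
     (\<forall>\<rho>. range \<rho> \<subseteq> C \<longrightarrow> f \<rho> \<in> C) \<and> (\<forall>\<rho>. range \<rho> \<subseteq> A0 \<longrightarrow> f \<rho> \<in> A0) \<and>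
     (\<forall>k \<rho> \<rho>'. (\<forall>n. (\<rho> n, \<rho>' n) \<in> g k) \<longrightarrow> (f \<rho>, f \<rho>') \<in> g k)"

definition compatible3 :: "('a \<Rightarrow> 'a \<Rightarrow> 'a \<Rightarrow> 'a) \<Rightarrow> bool" where
  "compatible3 D \<longleftrightarrow>
     (\<forall>x \<in> C. \<forall>y \<in> C. \<forall>z \<in> C. D x y z \<in> C) \<and> (\<forall>x \<in> A0. \<forall>y \<in> A0. \<forall>z \<in> A0. D x y z \<in> A0) \<and>
     (\<forall>k x x' y y' z z'. (x, x') \<in> g k \<longrightarrow> (y, y') \<in> g k \<longrightarrow> (z, z') \<in> g k \<longrightarrow>
        (D x y z, D x' y' z') \<in> g k)"

lemma compatible_g: "compatible f \<Longrightarrow> (\<And>n. (\<rho> n, \<rho>' n) \<in> g k) \<Longrightarrow> (f \<rho>, f \<rho>') \<in> g k"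
  by (simp add: compatible_def)

lemma compatible_C: "compatible f \<Longrightarrow> (\<And>n. \<rho> n \<in> C) \<Longrightarrow> f \<rho> \<in> C"
  unfolding compatible_def by (metis image_subsetI)

lemma compatible_A0: "compatible f \<Longrightarrow> (\<And>n. \<rho> n \<in> A0) \<Longrightarrow> f \<rho> \<in> A0"
  unfolding compatible_def by (metis image_subsetI)

lemma compatible3_g:
  "compatible3 D \<Longrightarrow> (x, x') \<in> g k \<Longrightarrow> (y, y') \<in> g k \<Longrightarrow> (z, z') \<in> g k \<Longrightarrow> (D x y z, D x' y' z') \<in> g k"
  by (simp add: compatible3_def)

lemma compatible3_C: "compatible3 D \<Longrightarrow> x \<in> C \<Longrightarrow> y \<in> C \<Longrightarrow> z \<in> C \<Longrightarrow> D x y z \<in> C"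
  by (simp add: compatible3_def)

lemma compatible3_A0: "compatible3 D \<Longrightarrow> x \<in> A0 \<Longrightarrow> y \<in> A0 \<Longrightarrow> z \<in> A0 \<Longrightarrow> D x y z \<in> A0"
  by (simp add: compatible3_def)

subsection \<open>The term condition\<close>

text \<open>Two of the three equivalences connect \<open>x\<close> with \<open>y\<close>. Moving along one link of such a chain, say in
\<open>g i\<close>, the values at \<open>s\<close> and \<open>s'\<close> stay \<open>g i\<close>-related, since they were equal before the move; being
\<open>g k\<close>-related as well, they are equal.\<close>

lemma term_condition:
  assumes h: "\<And>k x x' s s'. (x, x') \<in> g k \<Longrightarrow> (s, s') \<in> g k \<Longrightarrow> (h x s, h x' s') \<in> g k"
    and xy: "x \<in> C" "y \<in> C" and s: "(s, s') \<in> g k" and eq: "h x s = h x s'"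
  shows "h y s = h y s'"
proof -
  obtain i j where ij: "i \<noteq> j" "i \<noteq> k" "j \<noteq> k"
    by (cases k) (auto intro: that[of I0 I1] that[of I0 I2] that[of I1 I2])
  have "(x, y) \<in> (g i \<union> g j)\<^sup>*" using join_g[OF ij(1)] xy by auto
  then show ?thesis
  proof induction
    case base
    show ?case by (rule eq)
  next
    case (step y z)
    have "(h z s, h z s') \<in> g l" if "(y, z) \<in> g l" for l
    proof -
      have "(h y s, h z s) \<in> g l" "(h y s', h z s') \<in> g l"
        using h that g_refl s g_C by blast+
      then show ?thesis using step.IH g_sym g_trans by metis
    qed
    moreover have "(h z s, h z s') \<in> g k"
      using h s step.hyps(2) g_C g_refl by (metis UnE)
    ultimately show ?case using step.hyps(2) meet_g[OF ij(2)] meet_g[OF ij(3)] by blast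
  qed
qed

text \<open>Only finitely many coordinates matter, and \<open>term_condition\<close> changes them one by one.\<close>

lemma term_condition_many:
  assumes W: "finite W" "\<And>\<rho> \<rho>' s. (\<And>n. n \<in> W \<Longrightarrow> \<rho> n = \<rho>' n) \<Longrightarrow> f \<rho> s = f \<rho>' s"
    and f: "\<And>k \<rho> \<rho>' s s'. (\<And>n. (\<rho> n, \<rho>' n) \<in> g k) \<Longrightarrow> (s, s') \<in> g k \<Longrightarrow> (f \<rho> s, f \<rho>' s') \<in> g k"
    and \<rho>: "\<And>n. \<rho> n \<in> C" "\<And>n. \<rho>' n \<in> C"
    and s: "(s, s') \<in> g k" and eq: "f \<rho> s = f \<rho> s'"
  shows "f \<rho>' s = f \<rho>' s'"
proof -
  have "f (override_on \<rho> \<rho>' V) s = f (override_on \<rho> \<rho>' V) s'" if "finite V" for V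
    using that
  proof (induction V)
    case empty
    then show ?case using eq by simp
  next
    case (insert n V)
    let ?r = "override_on \<rho> \<rho>' V"
    have r: "?r m \<in> C" for m using \<rho> by (simp add: override_on_def)
    have "f (?r(n := \<rho>' n)) s = f (?r(n := \<rho>' n)) s'"
      by (rule term_condition[where h = "\<lambda>x. f (?r(n := x))" and x = "\<rho> n", OF _ \<rho> s])
         (use insert r in \<open>auto intro!: f simp: g_refl override_on_def fun_upd_idem\<close>)
    moreover have "?r(n := \<rho>' n) = override_on \<rho> \<rho>' (insert n V)"
      by (auto simp: override_on_def)
    ultimately show ?case by simp
  qed
  from this[OF W(1)] show ?thesis
    using W(2)[of "override_on \<rho> \<rho>' W" \<rho>'] by (simp add: override_on_def)
qed

text \<open>This lets the law \<open>D x a a = x\<close>, once known for related arguments, hold everywhere: by the term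
condition \<open>G x a\<close> is unchanged when \<open>a\<close> moves along one link, as \<open>G a a = G a a'\<close> holds locally, and a
chain of links leads from \<open>a\<close> to \<open>x\<close>.\<close>

lemma extend_absorption:
  assumes G: "\<And>k x x' a a'. (x, x') \<in> g k \<Longrightarrow> (a, a') \<in> g k \<Longrightarrow> (G x a, G x' a') \<in> g k"
    and loc: "\<And>k x a. (x, a) \<in> g k \<Longrightarrow> G x a = x"
    and xa: "x \<in> C" "a \<in> C"
  shows "G x a = x"
proof -
  \<comment> \<open>for the first argument \<open>b\<close> both values are \<open>b\<close> by the local law\<close>
  have step: "G x b = G x b'" if "(b, b') \<in> g k" for b b' k
    by (rule term_condition[where h = G and x = b, OF G _ xa(1) that])
       (use that loc g_refl g_C in auto)
  have "G x a = G x y" if "(a, y) \<in> (g I0 \<union> g I1)\<^sup>*" for y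
    using that by induction (use step in auto)
  moreover have "(a, x) \<in> (g I0 \<union> g I1)\<^sup>*" using join_g[of I0 I1] xa by auto
  ultimately have "G x a = G x x" by blast
  then show ?thesis using loc g_refl xa by metis
qed

subsection \<open>Cancellable coordinates\<close>

abbreviation put :: "('v \<Rightarrow> 'a) \<Rightarrow> 'v set \<Rightarrow> 'a \<Rightarrow> 'v \<Rightarrow> 'a" where
  "put \<rho> J a \<equiv> override_on \<rho> (\<lambda>_. a) J"

text \<open>In an affine algebra over a ring, if \<open>r\<close> is the sum of the coefficients of \<open>f\<close> on \<open>J\<close>, the operation
\<open>D x a b = x - r a + r b\<close> is as required: it replaces \<open>a\<close> by \<open>b\<close> on the coordinates in \<open>J\<close>, whatever the
values elsewhere. The replacement is asked for related \<open>a\<close> and \<open>b\<close> only, since the term condition is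
available only there.\<close>

definition cancellable :: "(('v \<Rightarrow> 'a) \<Rightarrow> 'a) \<Rightarrow> 'v set \<Rightarrow> bool" where
  "cancellable f J \<longleftrightarrow> (\<exists>D. compatible3 D \<and> (\<forall>x \<in> C. \<forall>a \<in> C. D x a a = x) \<and>
     (\<forall>k a b \<rho>. (a, b) \<in> g k \<longrightarrow> range \<rho> \<subseteq> C \<longrightarrow> D (f (put \<rho> J a)) a b = f (put \<rho> J b)))"

lemma cancellable_empty: "cancellable f {}"
  unfolding cancellable_def by (rule exI[of _ "\<lambda>x _ _. x"]) (auto simp: compatible3_def)

text \<open>Replace first on \<open>J\<close>, then at \<open>n\<close>, composing the two witnesses.\<close>

lemma cancellable_insert:
  fixes f :: "('v \<Rightarrow> 'a) \<Rightarrow> 'a"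
  assumes "cancellable f {n}" "cancellable f J"
  shows "cancellable f (insert n J)"
proof (cases "n \<in> J")
  case True
  then show ?thesis using assms by (simp add: insert_absorb)
next
  case False
  obtain D where D: "compatible3 D" "\<And>x a. x \<in> C \<Longrightarrow> a \<in> C \<Longrightarrow> D x a a = x"
    "\<And>k a b \<rho>. (a, b) \<in> g k \<Longrightarrow> range \<rho> \<subseteq> C \<Longrightarrow> D (f (put \<rho> {n} a)) a b = f (put \<rho> {n} b)"
    using assms(1) unfolding cancellable_def by blast
  obtain D' where D': "compatible3 D'" "\<And>x a. x \<in> C \<Longrightarrow> a \<in> C \<Longrightarrow> D' x a a = x"
    "\<And>k a b \<rho>. (a, b) \<in> g k \<Longrightarrow> range \<rho> \<subseteq> C \<Longrightarrow> D' (f (put \<rho> J a)) a b = f (put \<rho> J b)"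
    using assms(2) unfolding cancellable_def by blast
  show ?thesis unfolding cancellable_def
  proof (intro exI[of _ "\<lambda>x a b. D (D' x a b) a b"] conjI allI impI ballI)
    show "compatible3 (\<lambda>x a b. D (D' x a b) a b)"
      using D(1) D'(1) unfolding compatible3_def by simp
    fix x a assume "x \<in> C" "a \<in> C"
    then show "D (D' x a a) a a = x" using D D' by simp
  next
    fix k a b and \<rho> :: "'v \<Rightarrow> 'a" assume ab: "(a, b) \<in> g k" and \<rho>: "range \<rho> \<subseteq> C"
    have C: "range (put \<rho> {n} a) \<subseteq> C" "range (put \<rho> J b) \<subseteq> C"
      using \<rho> g_C[OF ab] by (auto simp: override_on_def)
    have "put \<rho> (insert n J) a = put (put \<rho> {n} a) J a"
      "put (put \<rho> {n} a) J b = put (put \<rho> J b) {n} a"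
      "put (put \<rho> J b) {n} b = put \<rho> (insert n J) b"
      using False by (auto simp: override_on_def)
    then show "D (D' (f (put \<rho> (insert n J) a)) a b) a b = f (put \<rho> (insert n J) b)"
      using D'(3)[OF ab C(1)] D(3)[OF ab C(2)] by simp
  qed
qed

lemma cancellable_union:
  assumes "compatible f" "\<And>n. n \<in> J \<Longrightarrow> cancellable f {n}"
  shows "cancellable f J"
proof -
  obtain W where W: "finite W" "\<And>\<rho> \<rho>'. (\<And>n. n \<in> W \<Longrightarrow> \<rho> n = \<rho>' n) \<Longrightarrow> f \<rho> = f \<rho>'"
    using assms(1) unfolding compatible_def by metis
  have "cancellable f V" if "finite V" "V \<subseteq> J" for V
    using that by induction (blast intro: cancellable_empty cancellable_insert assms(2))+
  from this[of "J \<inter> W"] have "cancellable f (J \<inter> W)" using W(1) by simp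
  moreover have "f (put \<rho> (J \<inter> W) a) = f (put \<rho> J a)" for \<rho> a
    by (rule W(2)) (simp add: override_on_def)
  ultimately show ?thesis unfolding cancellable_def by simp
qed

text \<open>Write \<open>s\<close> for the coefficient of \<open>J\<close> and \<open>r\<close> for that of \<open>j\<close>. The term \<open>f\<close> with \<open>b\<close> at \<open>j\<close>, with \<open>a\<close> on
the rest of \<open>J\<close> and \<open>x\<close> elsewhere is \<open>(1 - s) x + (s - r) a + r b\<close>; replacing \<open>a\<close> by \<open>x\<close> with weight \<open>s\<close>
gives \<open>x - r a + r b\<close>, which is the witness \<open>E\<close>. The hypothesis on \<open>D\<close> concerns valuations that are
constant outside \<open>J\<close> only; this is what survives when variables are identified.\<close>

lemma cancellable_member:
  assumes f: "compatible f" and idem_term: "\<And>a. a \<in> C \<Longrightarrow> f (\<lambda>_. a) = a"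
    and D: "compatible3 D" "\<And>x a. x \<in> C \<Longrightarrow> a \<in> C \<Longrightarrow> D x a a = x"
    and can: "\<And>k a b. (a, b) \<in> g k \<Longrightarrow> D (f (put (\<lambda>_. b) J a)) a b = b"
    and j: "j \<in> J"
  shows "cancellable f {j}"
proof -
  define E where "E x a b = D (f (\<lambda>m. if m = j then b else if m \<in> J then a else x)) a x" for x a b
  have E: "compatible3 E"
    unfolding compatible3_def
  proof (intro conjI ballI allI impI)
    fix x y z assume "x \<in> C" "y \<in> C" "z \<in> C"
    then show "E x y z \<in> C" unfolding E_def by (intro compatible3_C[OF D(1)] compatible_C[OF f]) auto
  next
    fix x y z assume "x \<in> A0" "y \<in> A0" "z \<in> A0"
    then show "E x y z \<in> A0" unfolding E_def by (intro compatible3_A0[OF D(1)] compatible_A0[OF f]) auto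
  next
    fix k x x' y y' z z' assume "(x, x') \<in> g k" "(y, y') \<in> g k" "(z, z') \<in> g k"
    then show "(E x y z, E x' y' z') \<in> g k"
      unfolding E_def by (intro compatible3_g[OF D(1)] compatible_g[OF f]) auto
  qed
  \<comment> \<open>for related \<open>x\<close> and \<open>a\<close> the hypothesis on \<open>D\<close> applies; \<open>extend_absorption\<close> removes the restriction\<close>
  have Exaa: "E x a a = x" if "x \<in> C" "a \<in> C" for x a
  proof (rule extend_absorption[where G = "\<lambda>x a. E x a a", OF _ _ that])
    show "(E x a a, E x' a' a') \<in> g k" if "(x, x') \<in> g k" "(a, a') \<in> g k" for x x' a a' k
      using compatible3_g[OF E] that by blast
    show "E x a a = x" if "(x, a) \<in> g k" for k x a
    proof -
      have "(\<lambda>m. if m = j then a else if m \<in> J then a else x) = put (\<lambda>_. x) J a"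
        using j by (auto simp: override_on_def)
      then show ?thesis using can[OF g_sym[OF that]] by (simp add: E_def)
    qed
  qed
  obtain W where W: "finite W" "\<And>\<rho> \<rho>'. (\<And>n. n \<in> W \<Longrightarrow> \<rho> n = \<rho>' n) \<Longrightarrow> f \<rho> = f \<rho>'"
    using f unfolding compatible_def by metis
  have "E (f (\<rho>(j := a))) a b = f (\<rho>(j := b))" if ab: "(a, b) \<in> g k" and \<rho>: "range \<rho> \<subseteq> C" for k a b \<rho>
  proof -
    have C: "a \<in> C" "b \<in> C" "\<And>n. \<rho> n \<in> C" using g_C[OF ab] \<rho> by auto
    \<comment> \<open>at the constant valuation \<open>a\<close> the values of \<open>P\<close> at \<open>a\<close> and \<open>b\<close> agree by direct computation, so
      the term condition makes them agree at every valuation\<close>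
    define P where "P \<rho> s = E (f (\<rho>(j := s))) s b" for \<rho> s
    have fC: "f ((\<lambda>_. a)(j := b)) \<in> C" using C by (intro compatible_C[OF f]) auto
    have "P (\<lambda>_. a) a = E a a b" using idem_term C by (simp add: P_def fun_upd_idem)
    also have "\<dots> = D (f ((\<lambda>_. a)(j := b))) a a"
      unfolding E_def by (rule arg_cong[of _ _ "\<lambda>r. D (f r) a a"]) auto
    also have "\<dots> = f ((\<lambda>_. a)(j := b))" using D(2) fC C by simp
    also have "\<dots> = P (\<lambda>_. a) b" using Exaa[OF fC C(2)] by (simp add: P_def)
    finally have "P (\<lambda>_. a) a = P (\<lambda>_. a) b" .
    then have "P \<rho> a = P \<rho> b"
    proof (rule term_condition_many[where f = P, OF W(1) _ _ _ C(3) ab, rotated -1])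
      fix \<rho> \<rho>' :: "'b \<Rightarrow> 'a" and s assume "\<And>n. n \<in> W \<Longrightarrow> \<rho> n = \<rho>' n"
      then show "P \<rho> s = P \<rho>' s"
        unfolding P_def using W(2)[of "\<rho>(j := s)" "\<rho>'(j := s)"] by simp
    next
      fix k s s' and \<rho> \<rho>' :: "'b \<Rightarrow> 'a"
      assume "\<And>n. (\<rho> n, \<rho>' n) \<in> g k" "(s, s') \<in> g k"
      then show "(P \<rho> s, P \<rho>' s') \<in> g k"
        unfolding P_def using C g_refl by (intro compatible3_g[OF E] compatible_g[OF f]) auto
    qed (use C in auto)
    moreover have "P \<rho> b = f (\<rho>(j := b))"
      unfolding P_def using C by (intro Exaa compatible_C[OF f]) auto
    ultimately show ?thesis by (simp add: P_def)
  qed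
  moreover have "put \<rho> {j} a = \<rho>(j := a)" for \<rho> :: "'b \<Rightarrow> 'a" and a
    by (auto simp: override_on_def)
  ultimately show ?thesis unfolding cancellable_def using E Exaa by (intro exI[of _ E]) auto
qed

text \<open>In the affine picture, the support of \<open>f\<close> modulo the ideal of coefficients \<open>r\<close> for which \<open>x - r a + r b\<close> is an operation.\<close>

definition essential :: "(('v \<Rightarrow> 'a) \<Rightarrow> 'a) \<Rightarrow> 'v set" where
  "essential f = {n. \<not> cancellable f {n}}"

text \<open>Identifying variables turns the fibre over \<open>n\<close> into one coordinate, and a fibre is cancellable exactly
if its members are.\<close>

lemma essential_rename:
  assumes f: "compatible f" and idem_term: "\<And>a. a \<in> C \<Longrightarrow> f (\<lambda>_. a) = a"
  shows "essential (\<lambda>\<rho>. f (\<rho> \<circ> \<sigma>)) = \<sigma> ` essential f"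
proof -
  have eq: "put \<rho> {n} a \<circ> \<sigma> = put (\<rho> \<circ> \<sigma>) (\<sigma> -` {n}) a" for \<rho> :: "'c \<Rightarrow> 'a" and n a
    by (auto simp: override_on_def)
  have "cancellable (\<lambda>\<rho>. f (\<rho> \<circ> \<sigma>)) {n} \<longleftrightarrow> (\<forall>m. \<sigma> m = n \<longrightarrow> cancellable f {m})" for n
  proof
    assume "cancellable (\<lambda>\<rho>. f (\<rho> \<circ> \<sigma>)) {n}"
    then obtain D where D: "compatible3 D" "\<And>x a. x \<in> C \<Longrightarrow> a \<in> C \<Longrightarrow> D x a a = x"
      "\<And>k a b \<rho>. (a, b) \<in> g k \<Longrightarrow> range \<rho> \<subseteq> C \<Longrightarrow>
          D (f (put (\<rho> \<circ> \<sigma>) (\<sigma> -` {n}) a)) a b = f (put (\<rho> \<circ> \<sigma>) (\<sigma> -` {n}) b)"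
      unfolding cancellable_def eq by blast
    \<comment> \<open>only valuations constant on the fibres are controlled, and the constant one suffices\<close>
    have "D (f (put (\<lambda>_. b) (\<sigma> -` {n}) a)) a b = b" if "(a, b) \<in> g k" for k a b
    proof -
      have "put (\<lambda>_. b) (\<sigma> -` {n}) b = (\<lambda>_. b)" by (auto simp: override_on_def)
      then show ?thesis
        using D(3)[OF that, of "\<lambda>_. b"] g_C[OF that] idem_term by (auto simp: comp_def)
    qed
    from cancellable_member[OF f idem_term D(1,2) this]
    show "\<forall>m. \<sigma> m = n \<longrightarrow> cancellable f {m}" by simp
  next
    assume "\<forall>m. \<sigma> m = n \<longrightarrow> cancellable f {m}"
    then have "cancellable f (\<sigma> -` {n})" by (rule_tac cancellable_union[OF f]) simp
    then obtain D where D: "compatible3 D" "\<And>x a. x \<in> C \<Longrightarrow> a \<in> C \<Longrightarrow> D x a a = x"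
      "\<And>k a b \<rho>. (a, b) \<in> g k \<Longrightarrow> range \<rho> \<subseteq> C \<Longrightarrow>
          D (f (put \<rho> (\<sigma> -` {n}) a)) a b = f (put \<rho> (\<sigma> -` {n}) b)"
      unfolding cancellable_def by blast
    then have "D (f (put (\<rho> \<circ> \<sigma>) (\<sigma> -` {n}) a)) a b = f (put (\<rho> \<circ> \<sigma>) (\<sigma> -` {n}) b)"
      if "(a, b) \<in> g k" "range \<rho> \<subseteq> C" for k a b \<rho>
      using that(2) by (intro D(3)[OF that(1)]) auto
    then show "cancellable (\<lambda>\<rho>. f (\<rho> \<circ> \<sigma>)) {n}"
      unfolding cancellable_def eq using D(1,2) by (intro exI[of _ D]) blast
  qed
  then show ?thesis unfolding essential_def by blast
qed

text \<open>Here \<open>D x a b\<close> acts as \<open>x - a + b\<close>. For a parameter tuple \<open>\<rho>\<close>, the expression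
\<open>f(\<rho>, x) - f(c, x) + f(c, d)\<close> has the same value at \<open>x = c\<close> and \<open>x = d\<close>: this is clear when \<open>\<rho>\<close> is
constantly \<open>c\<close>, and the term condition transfers it to all \<open>\<rho>\<close>. At \<open>x = c\<close> it is built from members of
\<open>A0\<close>, and at \<open>x = d\<close> it is \<open>f(\<rho>, d)\<close>.\<close>

lemma cancellable_proj_moves:
  fixes f :: "('w \<Rightarrow> 'a) \<Rightarrow> 'a"
  assumes gp: "cancellable (\<lambda>\<rho> :: 'v \<Rightarrow> 'a. \<rho> n) {n}" and f: "compatible f" and \<rho>: "range \<rho> \<subseteq> C"
    and cd: "(c, d) \<in> g k" "c \<in> A0" "d \<in> A0" and fc: "f (\<rho>(v := c)) \<in> A0"
  shows "f (\<rho>(v := d)) \<in> A0"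
proof -
  obtain D where D: "compatible3 D" "\<And>x a. x \<in> C \<Longrightarrow> a \<in> C \<Longrightarrow> D x a a = x"
    "\<And>k a b \<rho>. (a, b) \<in> g k \<Longrightarrow> range \<rho> \<subseteq> C \<Longrightarrow>
        D (put \<rho> {n} a n) a b = put \<rho> {n} b n"
    using gp unfolding cancellable_def by blast
  have D3: "D a a b = b" if "(a, b) \<in> g k" for k a b
    using D(3)[OF that, of "\<lambda>_. a"] g_C[OF that] by auto
  define o' where "o' = (\<lambda>_ :: 'w. c)"
  have C: "c \<in> C" "d \<in> C" "\<And>w. \<rho> w \<in> C" using cd A0_sub \<rho> by auto
  define P where "P \<rho> x = D (f (\<rho>(v := x))) (f (o'(v := x))) (f (o'(v := d)))" for \<rho> x
  have fC: "f (o'(v := d)) \<in> C" "f (\<rho>(v := d)) \<in> C"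
    using C by (auto intro!: compatible_C[OF f] simp: o'_def)
  obtain W where W: "finite W" "\<And>\<rho> \<rho>'. (\<And>n. n \<in> W \<Longrightarrow> \<rho> n = \<rho>' n) \<Longrightarrow> f \<rho> = f \<rho>'"
    using f unfolding compatible_def by metis
  have fx: "(f (o'(v := x)), f (o'(v := d))) \<in> g k" if "(x, d) \<in> g k" for x
    using that C g_refl by (intro compatible_g[OF f]) (auto simp: o'_def)
  have "P o' c = P o' d"
    using D3[OF fx[OF cd(1)]] D3[OF fx[OF g_refl[OF C(2)]]] by (simp add: P_def)
  then have "P \<rho> c = P \<rho> d"
  proof (rule term_condition_many[where f = P, OF W(1) _ _ _ C(3) cd(1), rotated -1])
    fix \<rho> \<rho>' :: "'w \<Rightarrow> 'a" and s assume "\<And>n. n \<in> W \<Longrightarrow> \<rho> n = \<rho>' n"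
    then show "P \<rho> s = P \<rho>' s"
      unfolding P_def using W(2)[of "\<rho>(v := s)" "\<rho>'(v := s)"] by simp
  next
    fix k s s' and \<rho> \<rho>' :: "'w \<Rightarrow> 'a"
    assume "\<And>n. (\<rho> n, \<rho>' n) \<in> g k" "(s, s') \<in> g k"
    then show "(P \<rho> s, P \<rho>' s') \<in> g k"
      unfolding P_def o'_def using C g_refl by (intro compatible3_g[OF D(1)] compatible_g[OF f]) auto
  qed (use C in \<open>auto simp: o'_def\<close>)
  moreover have "P \<rho> d = f (\<rho>(v := d))" unfolding P_def using D(2) fC by simp
  moreover have "P \<rho> c \<in> A0"
    unfolding P_def o'_def using cd by (intro compatible3_A0[OF D(1) fc] compatible_A0[OF f]) auto
  ultimately show ?thesis by simp
qed

end

section \<open>Terms and congruences\<close>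

fun subst :: "('v \<Rightarrow> ('f, 'w) tm) \<Rightarrow> ('f, 'v) tm \<Rightarrow> ('f, 'w) tm" where
  "subst \<tau> (Var x) = \<tau> x"
| "subst \<tau> (Op f ts) = Op f (map (subst \<tau>) ts)"

abbreviation rename :: "('v \<Rightarrow> 'w) \<Rightarrow> ('f, 'v) tm \<Rightarrow> ('f, 'w) tm" where
  "rename \<sigma> \<equiv> subst (\<lambda>x. Var (\<sigma> x))"

abbreviation subalgebra :: "('f \<Rightarrow> nat) \<Rightarrow> ('f, 'a) algebra \<Rightarrow> 'a set \<Rightarrow> bool" where
  "subalgebra ar A S \<equiv> is_algebra ar (A\<lparr>carrier := S\<rparr>)"

lemma wf_subst:
  assumes "wf_tm ar t" "\<And>x. wf_tm ar (\<tau> x)"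
  shows "wf_tm ar (subst \<tau> t)"
  using assms(1) by (induction t) (auto simp: assms(2))

lemma eval_subst: "eval_tm A \<rho> (subst \<tau> t) = eval_tm A (\<lambda>x. eval_tm A \<rho> (\<tau> x)) t"
proof (induction t)
  case (Op f ts)
  then have "map (eval_tm A \<rho> \<circ> subst \<tau>) ts = map (eval_tm A (\<lambda>x. eval_tm A \<rho> (\<tau> x))) ts" by simp
  then show ?case by (simp only: eval_tm.simps subst.simps map_map)
qed simp

lemma eval_rename: "eval_tm A \<rho> (rename \<sigma> t) = eval_tm A (\<rho> \<circ> \<sigma>) t"
  by (simp add: eval_subst comp_def)

lemma eval_carrier_update: "eval_tm (A\<lparr>carrier := S\<rparr>) \<rho> t = eval_tm A \<rho> t"
proof (induction t)
  case (Op f ts)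
  then have "map (eval_tm (A\<lparr>carrier := S\<rparr>) \<rho>) ts = map (eval_tm A \<rho>) ts" by simp
  then show ?case by (simp only: eval_tm.simps) simp
qed simp

lemma opn_closed:
  "is_algebra ar A \<Longrightarrow> length xs = ar f \<Longrightarrow> set xs \<subseteq> carrier A \<Longrightarrow> opn A f xs \<in> carrier A"
  by (simp add: is_algebra_def)

lemma opn_cong:
  "congruence ar A \<theta> \<Longrightarrow> length xs = ar f \<Longrightarrow> list_all2 (\<lambda>x y. (x, y) \<in> \<theta>) xs ys
     \<Longrightarrow> (opn A f xs, opn A f ys) \<in> \<theta>"
  by (simp add: congruence_def)

lemma eval_closed:
  assumes "is_algebra ar A" "wf_tm ar t" "\<And>x. \<rho> x \<in> carrier A"
  shows "eval_tm A \<rho> t \<in> carrier A"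
  using assms(2)
proof (induction t)
  case (Op f ts)
  then show ?case by (simp, intro opn_closed[OF assms(1)]) auto
qed (simp add: assms(3))

lemma eval_congruence:
  assumes "congruence ar A \<theta>" "wf_tm ar t" "\<And>x. (\<rho> x, \<rho>' x) \<in> \<theta>"
  shows "(eval_tm A \<rho> t, eval_tm A \<rho>' t) \<in> \<theta>"
  using assms(2)
proof (induction t)
  case (Op f ts)
  then show ?case
    by (simp, intro opn_cong[OF assms(1)]) (auto simp: list_all2_conv_all_nth)
qed (simp add: assms(3))

lemma eval_finite_support:
  "\<exists>W. finite W \<and> (\<forall>\<rho> \<rho>'. (\<forall>n \<in> W. \<rho> n = \<rho>' n) \<longrightarrow> eval_tm A \<rho> t = eval_tm A \<rho>' t)"
proof (induction t)
  case (Var x)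
  then show ?case by (intro exI[of _ "{x}"]) simp
next
  case (Op f ts)
  then obtain W where W: "\<And>t. t \<in> set ts \<Longrightarrow> finite (W t)"
    "\<And>t \<rho> \<rho>'. t \<in> set ts \<Longrightarrow> (\<And>n. n \<in> W t \<Longrightarrow> \<rho> n = \<rho>' n) \<Longrightarrow> eval_tm A \<rho> t = eval_tm A \<rho>' t"
    by metis
  have "eval_tm A \<rho> (Op f ts) = eval_tm A \<rho>' (Op f ts)"
    if "\<forall>n \<in> \<Union>(W ` set ts). \<rho> n = \<rho>' n" for \<rho> \<rho>'
  proof -
    have "map (eval_tm A \<rho>) ts = map (eval_tm A \<rho>') ts"
      using that by (intro map_cong refl W(2)) auto
    then show ?thesis by (simp only: eval_tm.simps)
  qed
  then show ?case using W(1) by (intro exI[of _ "\<Union>(W ` set ts)"]) blast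
qed

text \<open>It suffices to change one argument of an operation at a time; the arguments in \<open>us\<close> are those
already changed.\<close>

lemma congruenceI_translations:
  assumes eq: "equiv (carrier A) \<theta>"
    and alg: "is_algebra ar A"
    and step: "\<And>f us x y vs. (x, y) \<in> \<theta> \<Longrightarrow> set us \<subseteq> carrier A \<Longrightarrow> set vs \<subseteq> carrier A \<Longrightarrow>
        Suc (length us + length vs) = ar f \<Longrightarrow> (opn A f (us @ x # vs), opn A f (us @ y # vs)) \<in> \<theta>"
  shows "congruence ar A \<theta>"
proof -
  have C: "x \<in> carrier A \<and> y \<in> carrier A" if "(x, y) \<in> \<theta>" for x y
    using eq that by (auto simp: equiv_def)
  have "(opn A f (us @ xs), opn A f (us @ ys)) \<in> \<theta>"
    if "list_all2 (\<lambda>x y. (x, y) \<in> \<theta>) xs ys" "set us \<subseteq> carrier A" "length us + length xs = ar f"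
    for f us xs ys
    using that
  proof (induction arbitrary: us rule: list_all2_induct)
    case Nil
    then have "opn A f us \<in> carrier A" using alg by (simp add: is_algebra_def)
    then show ?case using eq by (auto simp: equiv_def refl_on_def)
  next
    case (Cons x xs y ys)
    have xs: "set xs \<subseteq> carrier A"
      using Cons.hyps(2) C by (induction rule: list_all2_induct) auto
    have "(opn A f (us @ x # xs), opn A f (us @ y # xs)) \<in> \<theta>"
      using Cons.prems by (intro step Cons.hyps xs) auto
    moreover have "(opn A f ((us @ [y]) @ xs), opn A f ((us @ [y]) @ ys)) \<in> \<theta>"
      using Cons.prems C[OF Cons.hyps(1)] by (intro Cons.IH) auto
    ultimately show ?case using eq by (auto simp: equiv_def elim: transE)
  qed
  from this[of _ _ "[]"] show ?thesis using eq by (simp add: congruence_def)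
qed

lemma congruence_equiv: "congruence ar A \<theta> \<Longrightarrow> equiv (carrier A) \<theta>"
  by (simp add: congruence_def)

lemma congruence_sub: "congruence ar A \<theta> \<Longrightarrow> \<theta> \<subseteq> carrier A \<times> carrier A"
  by (simp add: congruence_def equiv_def)

lemma congruence_refl: "congruence ar A \<theta> \<Longrightarrow> x \<in> carrier A \<Longrightarrow> (x, x) \<in> \<theta>"
  by (auto simp: congruence_def equiv_def refl_on_def)

lemma congruence_sym: "congruence ar A \<theta> \<Longrightarrow> (x, y) \<in> \<theta> \<Longrightarrow> (y, x) \<in> \<theta>"
  by (auto simp: congruence_def equiv_def sym_def)

lemma congruence_trans: "congruence ar A \<theta> \<Longrightarrow> (x, y) \<in> \<theta> \<Longrightarrow> (y, z) \<in> \<theta> \<Longrightarrow> (x, z) \<in> \<theta>"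
  by (metis congruence_def equiv_def transD)

lemma congruence_Int: "congruence ar A \<alpha> \<Longrightarrow> congruence ar A \<beta> \<Longrightarrow> congruence ar A (\<alpha> \<inter> \<beta>)"
  using congruence_Inter[of "{\<alpha>, \<beta>}" ar A] by auto

lemma congruence_translation:
  assumes "congruence ar A \<theta>" "(x, y) \<in> \<theta>" "set us \<subseteq> carrier A" "set vs \<subseteq> carrier A"
    "Suc (length us + length vs) = ar f"
  shows "(opn A f (us @ x # vs), opn A f (us @ y # vs)) \<in> \<theta>"
  using assms congruence_refl[OF assms(1)]
  by (intro opn_cong) (auto intro!: list_all2_appendI list.rel_refl_strong)

lemma congruence_join:
  assumes "is_algebra ar A" "congruence ar A \<alpha>" "congruence ar A \<beta>"
  shows "congruence ar A ((\<alpha> \<union> \<beta>)\<^sup>+)"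
proof (rule congruenceI_translations[OF _ assms(1)])
  show "equiv (carrier A) ((\<alpha> \<union> \<beta>)\<^sup>+)"
  proof (rule equivI)
    show "(\<alpha> \<union> \<beta>)\<^sup>+ \<subseteq> carrier A \<times> carrier A"
      using assms(2,3) by (intro trancl_subset_Sigma) (auto dest: congruence_sub)
    show "refl_on (carrier A) ((\<alpha> \<union> \<beta>)\<^sup>+)"
      using congruence_refl[OF assms(2)] by (auto simp: refl_on_def)
    show "sym ((\<alpha> \<union> \<beta>)\<^sup>+)"
      using congruence_sym[OF assms(2)] congruence_sym[OF assms(3)]
      by (intro sym_trancl) (auto simp: sym_def)
  qed simp
next
  fix f us x y vs
  assume "(x, y) \<in> (\<alpha> \<union> \<beta>)\<^sup>+" and h: "set us \<subseteq> carrier A" "set vs \<subseteq> carrier A"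
    "Suc (length us + length vs) = ar f"
  have *: "(opn A f (us @ x # vs), opn A f (us @ y # vs)) \<in> \<alpha> \<union> \<beta>" if "(x, y) \<in> \<alpha> \<union> \<beta>" for x y
    using that congruence_translation[OF assms(2) _ h] congruence_translation[OF assms(3) _ h]
    by blast
  show "(opn A f (us @ x # vs), opn A f (us @ y # vs)) \<in> (\<alpha> \<union> \<beta>)\<^sup>+"
    using \<open>(x, y) \<in> (\<alpha> \<union> \<beta>)\<^sup>+\<close> by induction (use * in \<open>blast intro: trancl_into_trancl\<close>)+
qed

lemma Con_simps [simp]: "carrier (Con ar A) = {\<theta>. congruence ar A \<theta>}" "le (Con ar A) = (\<subseteq>)"
  by (simp_all add: Con_def)

lemma partial_order_Con: "partial_order (Con ar A)"
  by unfold_locales (auto simp: Con_def)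

lemma join_Con:
  assumes "is_algebra ar A" "congruence ar A \<alpha>" "congruence ar A \<beta>"
  shows "\<alpha> \<squnion>\<^bsub>Con ar A\<^esub> \<beta> = (\<alpha> \<union> \<beta>)\<^sup>+"
proof -
  interpret partial_order "Con ar A" by (rule partial_order_Con)
  have "least (Con ar A) ((\<alpha> \<union> \<beta>)\<^sup>+) (Upper (Con ar A) {\<alpha>, \<beta>})"
  proof (rule least_UpperI)
    fix \<theta> assume "\<theta> \<in> Upper (Con ar A) {\<alpha>, \<beta>}"
    then have "\<alpha> \<union> \<beta> \<subseteq> \<theta>" "trans \<theta>"
      using assms by (auto simp: Upper_def congruence_def equiv_def)
    then show "(\<alpha> \<union> \<beta>)\<^sup>+ \<sqsubseteq>\<^bsub>Con ar A\<^esub> \<theta>"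
      using trancl_id[of \<theta>] trancl_mono[of _ "\<alpha> \<union> \<beta>" \<theta>] by auto
  qed (use assms congruence_join[OF assms] in auto)
  then show ?thesis
    unfolding join_def sup_def by (intro some_equality least_unique)
qed

lemma meet_Con:
  assumes "congruence ar A \<alpha>" "congruence ar A \<beta>"
  shows "\<alpha> \<sqinter>\<^bsub>Con ar A\<^esub> \<beta> = \<alpha> \<inter> \<beta>"
proof -
  interpret partial_order "Con ar A" by (rule partial_order_Con)
  have "greatest (Con ar A) (\<alpha> \<inter> \<beta>) (Lower (Con ar A) {\<alpha>, \<beta>})"
    by (rule greatest_LowerI) (use assms congruence_Int[OF assms] in \<open>auto simp: Lower_def\<close>)
  then show ?thesis
    unfolding meet_def inf_def by (intro some_equality greatest_unique)
qed

lemma congruence_generated: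
  assumes "is_algebra ar A" "R \<subseteq> carrier A \<times> carrier A"
  shows "congruence ar A (cong_generated ar A R)"
  unfolding cong_generated_def
  by (rule congruence_Inter) (use congruence_full[OF assms(1)] assms(2) in auto)

lemma generated_contains: "R \<subseteq> cong_generated ar A R"
  by (auto simp: cong_generated_def)

lemma generated_least: "congruence ar A \<theta> \<Longrightarrow> R \<subseteq> \<theta> \<Longrightarrow> cong_generated ar A R \<subseteq> \<theta>"
  by (auto simp: cong_generated_def)

lemma congruence_vimage:
  assumes "algebra_hom ar A B h" "is_algebra ar A" "congruence ar B \<theta>"
  shows "congruence ar A {(x, y). x \<in> carrier A \<and> y \<in> carrier A \<and> (h x, h y) \<in> \<theta>}"
    (is "congruence ar A ?\<theta>")
proof (rule congruenceI_translations[OF _ assms(2)])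
  have hB: "h x \<in> carrier B" if "x \<in> carrier A" for x
    using assms(1) that by (auto simp: algebra_hom_def)
  show "equiv (carrier A) ?\<theta>"
  proof (rule equivI)
    show "refl_on (carrier A) ?\<theta>"
      using hB congruence_refl[OF assms(3)] by (auto simp: refl_on_def)
    show "sym ?\<theta>" using congruence_sym[OF assms(3)] by (auto simp: sym_def)
    show "trans ?\<theta>" unfolding trans_def using congruence_trans[OF assms(3)] by blast
  qed auto
  fix f us x y vs
  assume xy: "(x, y) \<in> ?\<theta>" and h: "set us \<subseteq> carrier A" "set vs \<subseteq> carrier A"
    "Suc (length us + length vs) = ar f"
  have "(opn B f (map h us @ h x # map h vs), opn B f (map h us @ h y # map h vs)) \<in> \<theta>"
    using xy h hB by (intro congruence_translation[OF assms(3)]) auto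
  moreover have "h (opn A f (us @ z # vs)) = opn B f (map h us @ h z # map h vs)"
    if "z \<in> carrier A" for z
    using assms(1) h that by (auto simp: algebra_hom_def)
  ultimately show "(opn A f (us @ x # vs), opn A f (us @ y # vs)) \<in> ?\<theta>"
    using xy h by (auto intro!: opn_closed[OF assms(2)])
qed

subsection \<open>The syntactic congruence\<close>

text \<open>Unary polynomials are represented by terms over \<open>'a option\<close>: the variable \<open>None\<close> is the argument, and
\<open>Some a\<close> is the parameter \<open>a\<close>. The default for parameters outside the carrier keeps all values inside.\<close>

definition poly_val :: "('f, 'a) algebra \<Rightarrow> 'a \<Rightarrow> 'a option \<Rightarrow> 'a" where
  "poly_val A x v = (case v of None \<Rightarrow> x | Some a \<Rightarrow> if a \<in> carrier A then a else (SOME a. a \<in> carrier A))"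

text \<open>The largest congruence that has \<open>S\<close> as a union of classes, as in the theory of formal languages.\<close>

definition syntactic :: "('f \<Rightarrow> nat) \<Rightarrow> ('f, 'a) algebra \<Rightarrow> 'a set \<Rightarrow> ('a \<times> 'a) set" where
  "syntactic ar A S = {(x, y). x \<in> carrier A \<and> y \<in> carrier A \<and>
     (\<forall>t. wf_tm ar t \<longrightarrow> (eval_tm A (poly_val A x) t \<in> S \<longleftrightarrow> eval_tm A (poly_val A y) t \<in> S))}"

lemma poly_val_closed: "is_algebra ar A \<Longrightarrow> x \<in> carrier A \<Longrightarrow> poly_val A x v \<in> carrier A"
  by (auto simp: poly_val_def is_algebra_def some_in_eq split: option.split)

lemma congruence_syntactic:
  fixes A :: "('f, 'a) algebra"
  assumes alg: "is_algebra ar A"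
  shows "congruence ar A (syntactic ar A S)"
proof (rule congruenceI_translations[OF _ alg])
  show "equiv (carrier A) (syntactic ar A S)"
    by (rule equivI) (auto simp: syntactic_def refl_on_def sym_def trans_def)
  fix f us x y vs
  assume xy: "(x, y) \<in> syntactic ar A S" and h: "set us \<subseteq> carrier A" "set vs \<subseteq> carrier A"
    "Suc (length us + length vs) = ar f"
  \<comment> \<open>composition of a polynomial with the translation by \<open>us\<close> and \<open>vs\<close> is again a polynomial\<close>
  define \<tau> :: "'a option \<Rightarrow> ('f, 'a option) tm" where
    "\<tau> v = (case v of None \<Rightarrow> Op f (map (Var \<circ> Some) us @ Var None # map (Var \<circ> Some) vs)
               | Some a \<Rightarrow> Var (Some a))" for v
  have eq: "(\<lambda>v. eval_tm A (poly_val A z) (\<tau> v)) = poly_val A (opn A f (us @ z # vs))" for z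
  proof
    fix v
    have "map (\<lambda>u. poly_val A z (Some u)) us = us" "map (\<lambda>u. poly_val A z (Some u)) vs = vs"
      using h by (auto simp: poly_val_def intro!: map_idI)
    then show "eval_tm A (poly_val A z) (\<tau> v) = poly_val A (opn A f (us @ z # vs)) v"
      by (cases v) (simp_all add: \<tau>_def comp_def, simp_all add: poly_val_def)
  qed
  have "wf_tm ar (subst \<tau> t)" if "wf_tm ar t" for t
    using that by (rule wf_subst) (use h in \<open>auto simp: \<tau>_def split: option.split\<close>)
  moreover have "eval_tm A (poly_val A (opn A f (us @ z # vs))) t = eval_tm A (poly_val A z) (subst \<tau> t)"
    for z t by (simp add: eval_subst eq)
  ultimately have "eval_tm A (poly_val A (opn A f (us @ x # vs))) t \<in> S \<longleftrightarrow>
      eval_tm A (poly_val A (opn A f (us @ y # vs))) t \<in> S" if "wf_tm ar t" for t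
    using xy that unfolding syntactic_def by simp
  moreover have "opn A f (us @ z # vs) \<in> carrier A" if "z \<in> carrier A" for z
    using that h by (intro opn_closed[OF alg]) auto
  ultimately show "(opn A f (us @ x # vs), opn A f (us @ y # vs)) \<in> syntactic ar A S"
    using xy unfolding syntactic_def by blast
qed

lemma syntactic_saturates:
  assumes "(x, y) \<in> syntactic ar A S" "x \<in> S"
  shows "y \<in> S"
  using assms unfolding syntactic_def
  by (auto dest!: spec[of _ "Var None"] simp: poly_val_def)

section \<open>Essential variables of terms\<close>

text \<open>\<open>generates\<close> and \<open>proper\<close> are incompatible in an affine algebra, where every subalgebra is a class of a
congruence.\<close>

locale m3_algebra = m3_frame "carrier U" g A0
  for ar :: "'f \<Rightarrow> nat" and U :: "('f, 'a) algebra" and g and A0 :: "'a set" +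
  assumes alg: "is_algebra ar U"
    and cong_g: "congruence ar U (g k)"
    and sub_A0: "subalgebra ar U A0"
    and generates: "congruence ar U \<Theta> \<Longrightarrow> A0 \<times> A0 \<subseteq> \<Theta> \<Longrightarrow> \<Theta> = carrier U \<times> carrier U"
    and join_A0: "A0 \<times> A0 \<subseteq> ((\<Union>k. g k) \<inter> A0 \<times> A0)\<^sup>*"
    and proper: "A0 \<noteq> carrier U"
begin

lemma compatible_eval: "wf_tm ar t \<Longrightarrow> compatible (\<lambda>\<rho>. eval_tm U \<rho> t)"
  unfolding compatible_def
  using eval_finite_support[of U t] eval_closed[OF alg, of t] eval_closed[OF sub_A0, of t]
    eval_congruence[OF cong_g, of t]
  by (auto simp: eval_carrier_update image_subset_iff)

text \<open>Otherwise the syntactic congruence of \<open>A0\<close> contains every \<open>g k\<close>-pair inside \<open>A0\<close>, hence all of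
\<open>A0 \<times> A0\<close>, hence it is full, and \<open>A0\<close> is everything.\<close>

lemma proj_not_cancellable: "\<not> cancellable (\<lambda>\<rho> :: 'v \<Rightarrow> 'a. \<rho> n) {n}"
proof
  assume cancellable: "cancellable (\<lambda>\<rho> :: 'v \<Rightarrow> 'a. \<rho> n) {n}"
  let ?\<Theta> = "syntactic ar U A0"
  have move: "eval_tm U (poly_val U d) t \<in> A0"
    if "(c, d) \<in> g k" "c \<in> A0" "d \<in> A0" "wf_tm ar t" "eval_tm U (poly_val U c) t \<in> A0" for c d k t
  proof -
    have "poly_val U z = (poly_val U c)(None := z)" for z
      by (auto simp: poly_val_def split: option.split)
    then show ?thesis
      using cancellable_proj_moves[OF cancellable compatible_eval[OF that(4)] _ that(1-3), of "poly_val U c" None]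
        that poly_val_closed[OF alg] A0_sub by (metis image_subsetI subsetD)
  qed
  have moves: "(c, d) \<in> ?\<Theta>" if "(c, d) \<in> g k" "c \<in> A0" "d \<in> A0" for c d k
  proof -
    have "eval_tm U (poly_val U c) t \<in> A0 \<longleftrightarrow> eval_tm U (poly_val U d) t \<in> A0" if "wf_tm ar t" for t
      using move[OF \<open>(c, d) \<in> g k\<close> _ _ that] move[OF g_sym[OF \<open>(c, d) \<in> g k\<close>] _ _ that]
        \<open>c \<in> A0\<close> \<open>d \<in> A0\<close> by blast
    then show ?thesis using g_C[OF that(1)] by (simp add: syntactic_def)
  qed
  have "A0 \<times> A0 \<subseteq> ?\<Theta>"
  proof
    fix p assume "p \<in> A0 \<times> A0"
    then obtain x y where p: "p = (x, y)" "x \<in> A0" "(x, y) \<in> ((\<Union>k. g k) \<inter> A0 \<times> A0)\<^sup>*"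
      using join_A0 by auto
    from p(3) have "(x, y) \<in> ?\<Theta>"
    proof induction
      case base
      then show ?case using congruence_refl[OF congruence_syntactic[OF alg]] p(2) A0_sub by blast
    next
      case (step y z)
      then show ?case
        using congruence_trans[OF congruence_syntactic[OF alg]] moves by blast
    qed
    then show "p \<in> ?\<Theta>" using p by simp
  qed
  then have "?\<Theta> = carrier U \<times> carrier U" by (rule generates[OF congruence_syntactic[OF alg]])
  then have "y \<in> A0" if "x \<in> A0" "y \<in> carrier U" for x y
    using that A0_sub syntactic_saturates[of x y ar U A0] by auto
  then show False using proper sub_A0 A0_sub by (auto simp: is_algebra_def)
qed

lemma essential_proj: "essential (\<lambda>\<rho> :: 'v \<Rightarrow> 'a. \<rho> n) = {n}"
proof -
  have "cancellable (\<lambda>\<rho> :: 'v \<Rightarrow> 'a. \<rho> n) {m}" if "m \<noteq> n" for m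
    unfolding cancellable_def using that
    by (intro exI[of _ "\<lambda>x _ _. x"]) (simp add: compatible3_def override_on_def)
  then have "cancellable (\<lambda>\<rho> :: 'v \<Rightarrow> 'a. \<rho> n) {m} \<longleftrightarrow> m \<noteq> n" for m
    using proj_not_cancellable by metis
  then show ?thesis by (simp add: essential_def) 
qed

definition essential_vars :: "('f, 'v) tm \<Rightarrow> 'v set" where
  "essential_vars t = essential (\<lambda>\<rho>. eval_tm U \<rho> t)"

text \<open>Idempotence is tested in \<open>U\<close> because cancellability is: \<open>cancellable_member\<close> uses it there.\<close>

definition idem_term :: "('f, 'v) tm \<Rightarrow> bool" where
  "idem_term t \<longleftrightarrow> (\<forall>a \<in> carrier U. eval_tm U (\<lambda>_. a) t = a)"

lemma essential_vars_Var: "essential_vars (Var n) = {n}"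
  by (simp add: essential_vars_def essential_proj)

lemma idem_term_Var: "idem_term (Var n)"
  by (simp add: idem_term_def)

lemma idem_term_rename: "idem_term (rename \<sigma> t) \<longleftrightarrow> idem_term t"
  by (simp add: idem_term_def eval_rename comp_def)

lemma essential_vars_rename: "wf_tm ar t \<Longrightarrow> idem_term t \<Longrightarrow> essential_vars (rename \<sigma> t) = \<sigma> ` essential_vars t"
  unfolding essential_vars_def eval_rename by (rule essential_rename[OF compatible_eval]) (auto simp: idem_term_def)

lemma essential_vars_cong:
  assumes "\<And>\<rho>. range \<rho> \<subseteq> carrier U \<Longrightarrow> eval_tm U \<rho> s = eval_tm U \<rho> t"
  shows "essential_vars s = essential_vars t"
proof -
  have "eval_tm U (put \<rho> J a) s = eval_tm U (put \<rho> J a) t"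
    if "range \<rho> \<subseteq> carrier U" "a \<in> carrier U" for \<rho> J a
    using that by (intro assms) (auto simp: override_on_def)
  then have "cancellable (\<lambda>\<rho>. eval_tm U \<rho> s) J \<longleftrightarrow> cancellable (\<lambda>\<rho>. eval_tm U \<rho> t) J" for J
    unfolding cancellable_def using g_C by (auto cong: conj_cong)
  then show ?thesis by (simp add: essential_vars_def essential_def)
qed

end

section \<open>The free algebra of a variety generated by one algebra\<close>

text \<open>Terms are identified when they agree in \<open>U\<close>, so the quotient is free in the variety generated by
\<open>U\<close>.\<close>

definition term_eq :: "('f \<Rightarrow> nat) \<Rightarrow> ('f, 'a) algebra \<Rightarrow> (('f, nat) tm \<times> ('f, nat) tm) set" where
  "term_eq ar U = {(s, t). wf_tm ar s \<and> wf_tm ar t \<and>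
     (\<forall>\<rho>. range \<rho> \<subseteq> carrier U \<longrightarrow> eval_tm U \<rho> s = eval_tm U \<rho> t)}"

definition term_class :: "('f \<Rightarrow> nat) \<Rightarrow> ('f, 'a) algebra \<Rightarrow> ('f, nat) tm \<Rightarrow> ('f, nat) tm set" where
  "term_class ar U t = term_eq ar U `` {t}"

definition term_rep :: "('f, nat) tm set \<Rightarrow> ('f, nat) tm" where
  "term_rep c = (SOME t. t \<in> c)"

definition free_alg :: "('f \<Rightarrow> nat) \<Rightarrow> ('f, 'a) algebra \<Rightarrow> ('f, ('f, nat) tm set) algebra" where
  "free_alg ar U = \<lparr>carrier = term_class ar U ` {t. wf_tm ar t},
     opn = (\<lambda>f cs. term_class ar U (Op f (map term_rep cs)))\<rparr>"

lemma equiv_term_eq: "equiv {t. wf_tm ar t} (term_eq ar U)"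
  by (rule equivI) (auto simp: term_eq_def refl_on_def sym_def trans_def)

lemma term_class_eq_iff:
  assumes "wf_tm ar s" "wf_tm ar t"
  shows "term_class ar U s = term_class ar U t \<longleftrightarrow> (s, t) \<in> term_eq ar U"
  unfolding term_class_def using assms equiv_term_eq[of ar U] by (simp add: eq_equiv_class_iff)

lemma term_rep:
  assumes "wf_tm ar t"
  shows "(t, term_rep (term_class ar U t)) \<in> term_eq ar U"
proof -
  have "t \<in> term_class ar U t" using assms by (auto simp: term_class_def term_eq_def)
  then have "term_rep (term_class ar U t) \<in> term_class ar U t"
    unfolding term_rep_def by (rule someI)
  then show ?thesis by (simp add: term_class_def)
qed

lemma term_rep_carrier:
  assumes "c \<in> carrier (free_alg ar U)"
  shows "wf_tm ar (term_rep c)" "term_class ar U (term_rep c) = c"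
proof -
  obtain t where t: "wf_tm ar t" "c = term_class ar U t"
    using assms by (auto simp: free_alg_def)
  have r: "(t, term_rep c) \<in> term_eq ar U" using term_rep[OF t(1)] t(2) by blast
  then show w: "wf_tm ar (term_rep c)" by (simp add: term_eq_def)
  show "term_class ar U (term_rep c) = c"
    using term_class_eq_iff[OF t(1) w, of U] r t(2) by simp
qed

lemma term_class_carrier: "wf_tm ar t \<Longrightarrow> term_class ar U t \<in> carrier (free_alg ar U)"
  by (simp add: free_alg_def)

lemma opn_free_alg:
  assumes "length ts = ar f" "\<And>t. t \<in> set ts \<Longrightarrow> wf_tm ar t"
  shows "opn (free_alg ar U) f (map (term_class ar U) ts) = term_class ar U (Op f ts)"
proof -
  have r: "(t, term_rep (term_class ar U t)) \<in> term_eq ar U" if "t \<in> set ts" for t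
    using assms(2)[OF that] by (rule term_rep)
  then have w: "wf_tm ar (term_rep (term_class ar U t))" if "t \<in> set ts" for t
    using that by (auto simp: term_eq_def)
  have "map (eval_tm U \<rho> \<circ> (term_rep \<circ> term_class ar U)) ts = map (eval_tm U \<rho>) ts"
    if "range \<rho> \<subseteq> carrier U" for \<rho>
    using that r by (intro map_cong refl) (simp add: term_eq_def)
  then have "(Op f (map (term_rep \<circ> term_class ar U) ts), Op f ts) \<in> term_eq ar U"
    using assms w unfolding term_eq_def by (simp del: map_eq_conv)
  then show ?thesis
    using term_class_eq_iff[of ar "Op f (map (term_rep \<circ> term_class ar U) ts)" "Op f ts" U] assms w
    by (simp add: free_alg_def)
qed

lemma is_algebra_free_alg: "is_algebra ar (free_alg ar U)"
proof -
  have "opn (free_alg ar U) f cs \<in> carrier (free_alg ar U)"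
    if "length cs = ar f" "set cs \<subseteq> carrier (free_alg ar U)" for f cs
  proof -
    have "wf_tm ar (Op f (map term_rep cs))"
      using that term_rep_carrier(1)[of _ ar U] by auto
    then show ?thesis by (simp add: free_alg_def)
  qed
  moreover have "term_class ar U (Var 0) \<in> carrier (free_alg ar U)"
    by (rule term_class_carrier) simp
  ultimately show ?thesis unfolding is_algebra_def by blast
qed

lemma eval_free_alg:
  assumes "wf_tm ar t" "\<And>x. wf_tm ar (\<tau> x)"
  shows "eval_tm (free_alg ar U) (\<lambda>x. term_class ar U (\<tau> x)) t = term_class ar U (subst \<tau> t)"
  using assms(1)
proof (induction t)
  case (Op f ts)
  have "map (eval_tm (free_alg ar U) (\<lambda>x. term_class ar U (\<tau> x))) ts =
      map (term_class ar U) (map (subst \<tau>) ts)"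
    using Op by simp
  moreover have "opn (free_alg ar U) f (map (term_class ar U) (map (subst \<tau>) ts)) =
      term_class ar U (Op f (map (subst \<tau>) ts))"
    using Op.prems by (intro opn_free_alg) (auto intro: wf_subst assms(2))
  ultimately show ?case by (simp only: eval_tm.simps subst.simps)
qed simp

lemma free_alg_in_variety:
  fixes U :: "('f, 'a) algebra"
  assumes "U \<in> in_variety ar E" "E \<subseteq> identities ar"
  shows "free_alg ar U \<in> in_variety ar E"
proof -
  have alg: "is_algebra ar U" using assms(1) by (simp add: in_variety_def)
  have "satisfies (free_alg ar U) s t" if "(s, t) \<in> E" for s t
    unfolding satisfies_def
  proof (intro allI impI)
    fix \<rho> :: "nat \<Rightarrow> ('f, nat) tm set" assume \<rho>: "range \<rho> \<subseteq> carrier (free_alg ar U)"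
    define \<tau> where "\<tau> x = term_rep (\<rho> x)" for x
    have w: "wf_tm ar s" "wf_tm ar t" "\<And>x. wf_tm ar (\<tau> x)"
      using that assms(2) \<rho> term_rep_carrier(1)[of _ ar U] by (auto simp: identities_def \<tau>_def image_subset_iff)
    have \<rho>_eq: "\<rho> = (\<lambda>x. term_class ar U (\<tau> x))"
      using \<rho> term_rep_carrier(2)[of _ ar U] by (auto simp: \<tau>_def image_subset_iff)
    have "satisfies U s t" using assms(1) that by (auto simp: in_variety_def)
    then have "(subst \<tau> s, subst \<tau> t) \<in> term_eq ar U"
      unfolding term_eq_def satisfies_def
      using wf_subst[OF w(1,3)] wf_subst[OF w(2,3)] eval_closed[OF alg w(3)]
      by (auto simp: eval_subst image_subset_iff)
    then show "eval_tm (free_alg ar U) \<rho> s = eval_tm (free_alg ar U) \<rho> t"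
      unfolding \<rho>_eq using w wf_subst[OF w(1,3)] wf_subst[OF w(2,3)] by (simp add: eval_free_alg term_class_eq_iff)
  qed
  then show ?thesis using is_algebra_free_alg by (auto simp: in_variety_def)
qed

definition var_cong ::
  "('f \<Rightarrow> nat) \<Rightarrow> ('f, 'a) algebra \<Rightarrow> (nat \<times> nat) set \<Rightarrow> (('f, nat) tm set \<times> ('f, nat) tm set) set"
  where "var_cong ar U R =
    cong_generated ar (free_alg ar U) {(term_class ar U (Var m), term_class ar U (Var n)) | m n. (m, n) \<in> R}"

lemma congruence_var_cong: "congruence ar (free_alg ar U) (var_cong ar U R)"
  unfolding var_cong_def
  by (rule congruence_generated[OF is_algebra_free_alg]) (auto intro!: term_class_carrier)

lemma var_cong_Var: "(m, n) \<in> R \<Longrightarrow> (term_class ar U (Var m), term_class ar U (Var n)) \<in> var_cong ar U R"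
  unfolding var_cong_def using generated_contains by fast

text \<open>A renaming that identifies the variables related by \<open>R\<close> induces an endomorphism of the free algebra
whose kernel contains the generating pairs.\<close>

lemma var_cong_rename:
  assumes alg: "is_algebra ar U" and R: "\<And>m n. (m, n) \<in> R \<Longrightarrow> \<sigma> m = \<sigma> n"
    and st: "(term_class ar U s, term_class ar U t) \<in> var_cong ar U R" "wf_tm ar s" "wf_tm ar t"
  shows "(rename \<sigma> s, rename \<sigma> t) \<in> term_eq ar U"
proof -
  define \<theta> where "\<theta> = {(c, d). c \<in> carrier (free_alg ar U) \<and> d \<in> carrier (free_alg ar U) \<and>
     (rename \<sigma> (term_rep c), rename \<sigma> (term_rep d)) \<in> term_eq ar U}"
  have iff: "(term_class ar U s, term_class ar U t) \<in> \<theta> \<longleftrightarrow> (rename \<sigma> s, rename \<sigma> t) \<in> term_eq ar U"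
    if w: "wf_tm ar s" "wf_tm ar t" for s t
  proof -
    have "range (\<rho> \<circ> \<sigma>) \<subseteq> carrier U" if "range \<rho> \<subseteq> carrier U" for \<rho> :: "nat \<Rightarrow> 'b"
      using that by auto
    moreover have "(s, term_rep (term_class ar U s)) \<in> term_eq ar U"
      "(t, term_rep (term_class ar U t)) \<in> term_eq ar U"
      using w by (auto intro: term_rep)
    ultimately show ?thesis
      using w unfolding \<theta>_def by (simp add: term_eq_def eval_rename term_class_carrier wf_subst)
  qed
  have cl: "\<exists>s. wf_tm ar s \<and> c = term_class ar U s" if "c \<in> carrier (free_alg ar U)" for c
    using that by (auto simp: free_alg_def)
  have "congruence ar (free_alg ar U) \<theta>"
  proof (rule congruenceI_translations[OF _ is_algebra_free_alg])
    show "equiv (carrier (free_alg ar U)) \<theta>"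
      by (rule equivI)
         (use term_rep_carrier(1)[of _ ar U] in
           \<open>auto simp: \<theta>_def refl_on_def sym_def trans_def term_eq_def intro!: wf_subst\<close>)
    fix f us vs and c d :: "('a, nat) tm set"
    assume cd: "(c, d) \<in> \<theta>" and us: "set us \<subseteq> carrier (free_alg ar U)" "set vs \<subseteq> carrier (free_alg ar U)"
      and l: "Suc (length us + length vs) = ar f"
    let ?us = "map term_rep us" and ?vs = "map term_rep vs"
    have map: "map (term_class ar U) ?us = us" "map (term_class ar U) ?vs = vs"
      using us term_rep_carrier(2)[of _ ar U] by (auto simp: comp_def intro!: map_idI)
    have op: "opn (free_alg ar U) f (us @ e # vs) = term_class ar U (Op f (?us @ term_rep e # ?vs))"
      if "e \<in> carrier (free_alg ar U)" for e
      using opn_free_alg[of "?us @ term_rep e # ?vs" ar f U] that us l term_rep_carrier[of _ ar U] map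
      by auto
    have w: "wf_tm ar (Op f (?us @ term_rep e # ?vs))" if "e \<in> carrier (free_alg ar U)" for e
      using that us l term_rep_carrier(1)[of _ ar U] by auto
    have C: "c \<in> carrier (free_alg ar U)" "d \<in> carrier (free_alg ar U)"
      and r: "(rename \<sigma> (term_rep c), rename \<sigma> (term_rep d)) \<in> term_eq ar U"
      using cd by (auto simp: \<theta>_def)
    have "(rename \<sigma> (Op f (?us @ term_rep c # ?vs)), rename \<sigma> (Op f (?us @ term_rep d # ?vs))) \<in> term_eq ar U"
      using r wf_subst[OF w[OF C(1)], of "\<lambda>x. Var (\<sigma> x)"] wf_subst[OF w[OF C(2)], of "\<lambda>x. Var (\<sigma> x)"]
      unfolding term_eq_def by simp
    then show "(opn (free_alg ar U) f (us @ c # vs), opn (free_alg ar U) f (us @ d # vs)) \<in> \<theta>"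
      unfolding op[OF C(1)] op[OF C(2)] using iff[OF w[OF C(1)] w[OF C(2)]] by simp
  qed
  moreover have "{(term_class ar U (Var m), term_class ar U (Var n)) | m n. (m, n) \<in> R} \<subseteq> \<theta>"
    using R by (auto simp: iff) (simp add: term_eq_def)
  ultimately have "var_cong ar U R \<subseteq> \<theta>" unfolding var_cong_def by (rule generated_least)
  then show ?thesis using st iff by blast
qed

section \<open>Lattice inequalities refuted by finite semilattices\<close>

text \<open>A union-closed family \<open>F\<close> of subsets of a finite set \<open>X\<close> determines the congruence \<open>sep X F\<close> of the
semilattice \<open>(\<PP>(X), \<inter>)\<close>, and larger families give smaller congruences. Hence joins of congruences
correspond to intersections of families, and meets to families of pairwise unions.\<close>

fun family_eval :: "(nat \<Rightarrow> 'x set set) \<Rightarrow> lat_tm \<Rightarrow> 'x set set" where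
  "family_eval F (LVar n) = F n"
| "family_eval F (LJoin p q) = family_eval F p \<inter> family_eval F q"
| "family_eval F (LMeet p q) = {a \<union> b | a b. a \<in> family_eval F p \<and> b \<in> family_eval F q}"

definition union_closed :: "'x set \<Rightarrow> 'x set set \<Rightarrow> bool" where
  "union_closed X F \<longleftrightarrow> F \<subseteq> Pow X \<and> {} \<in> F \<and> (\<forall>a \<in> F. \<forall>b \<in> F. a \<union> b \<in> F)"

text \<open>Both ways of combining two families below, and pairwise unions, are instances of this closure property.\<close>

lemma union_closed_image2:
  assumes "union_closed X F" "union_closed Y G"
    and "h {} {} = {}" "\<And>a b a' b'. h a b \<union> h a' b' = h (a \<union> a') (b \<union> b')"
    and "\<And>a b. a \<subseteq> X \<Longrightarrow> b \<subseteq> Y \<Longrightarrow> h a b \<subseteq> Z"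
  shows "union_closed Z {h a b | a b. a \<in> F \<and> b \<in> G}"
  unfolding union_closed_def
proof (intro conjI ballI)
  show "{h a b | a b. a \<in> F \<and> b \<in> G} \<subseteq> Pow Z"
  proof clarify
    fix a b x assume "a \<in> F" "b \<in> G" "x \<in> h a b"
    moreover from this have "a \<subseteq> X" "b \<subseteq> Y" using assms(1,2) by (auto simp: union_closed_def)
    ultimately show "x \<in> Z" using assms(5) by blast
  qed
  have "{} \<in> F" "{} \<in> G" using assms(1,2) by (auto simp: union_closed_def)
  then show "{} \<in> {h a b | a b. a \<in> F \<and> b \<in> G}"
    using assms(3)[symmetric] by blast
  fix c d assume "c \<in> {h a b | a b. a \<in> F \<and> b \<in> G}" "d \<in> {h a b | a b. a \<in> F \<and> b \<in> G}"
  then obtain a b a' b' where h: "c = h a b" "d = h a' b'" "a \<in> F" "b \<in> G" "a' \<in> F" "b' \<in> G"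
    by blast
  have "c \<union> d = h (a \<union> a') (b \<union> b')" "a \<union> a' \<in> F" "b \<union> b' \<in> G"
    using h assms(1,2,4) by (auto simp: union_closed_def)
  then show "c \<union> d \<in> {h a b | a b. a \<in> F \<and> b \<in> G}" by blast
qed

lemma union_closed_family_eval:
  assumes "\<And>n. union_closed X (F n)"
  shows "union_closed X (family_eval F r)"
proof (induction r)
  case (LVar n)
  then show ?case using assms by simp
next
  case (LJoin p q)
  then show ?case by (auto simp: union_closed_def)
next
  case (LMeet p q)
  then show ?case unfolding family_eval.simps by (rule union_closed_image2) auto
qed

text \<open>A map that commutes with unions embeds the evaluation in one system of families into another; it
carries a witness for a subterm over to the whole term.\<close>

lemma family_eval_map:
  assumes "\<And>n a. a \<in> F n \<Longrightarrow> h a \<in> G n" "\<And>a b. h (a \<union> b) = h a \<union> h b"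
  shows "a \<in> family_eval F r \<Longrightarrow> h a \<in> family_eval G r"
proof (induction r arbitrary: a)
  case (LMeet p q)
  then show ?case using assms(2) by auto blast
qed (auto simp: assms(1))

subsection \<open>Points of a lattice term\<close>

text \<open>A point of \<open>r\<close> records one side for every meet that it passes and pursues both sides of every join. The
occurrence of a variable in \<open>r\<close> yields the set of points that pass through it. Since the two components of a pair
are independent, sets from the two sides of a join cover all pairs only if one side alone covers its
component.\<close>

datatype point = PLeaf | PL point | PR point | PP point point

fun points :: "lat_tm \<Rightarrow> point set" where
  "points (LVar n) = {PLeaf}"
| "points (LMeet p q) = PL ` points p \<union> PR ` points q"
| "points (LJoin p q) = {PP x y | x y. x \<in> points p \<and> y \<in> points q}"

text \<open>The union of two cylinders, one over a set of first components and one over a set of second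
components.\<close>

definition cyl :: "lat_tm \<Rightarrow> lat_tm \<Rightarrow> point set \<Rightarrow> point set \<Rightarrow> point set" where
  "cyl p q a b = {PP x y | x y. x \<in> points p \<and> y \<in> points q \<and> (x \<in> a \<or> y \<in> b)}"

text \<open>The unions of sets of points attached to occurrences of variables with index in \<open>N\<close>.\<close>

fun leaf_family :: "lat_tm \<Rightarrow> nat set \<Rightarrow> point set set" where
  "leaf_family (LVar m) N = (if m \<in> N then {{}, {PLeaf}} else {{}})"
| "leaf_family (LMeet p q) N = {PL ` a \<union> PR ` b | a b. a \<in> leaf_family p N \<and> b \<in> leaf_family q N}"
| "leaf_family (LJoin p q) N = {cyl p q a b | a b. a \<in> leaf_family p N \<and> b \<in> leaf_family q N}"

lemma finite_points: "finite (points r)"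
proof (induction r)
  case (LJoin p q)
  have "points (LJoin p q) = (\<lambda>(x, y). PP x y) ` (points p \<times> points q)" by auto
  then show ?case using LJoin by simp
qed auto

lemma cyl_Un: "cyl p q a b \<union> cyl p q a' b' = cyl p q (a \<union> a') (b \<union> b')"
  by (auto simp: cyl_def)

lemma cyl_full_iff:
  assumes "a \<subseteq> points p" "b \<subseteq> points q"
  shows "cyl p q a b = points (LJoin p q) \<longleftrightarrow> a = points p \<or> b = points q"
  using assms by (auto simp: cyl_def)

lemma union_closed_leaf_family: "union_closed (points r) (leaf_family r N)"
proof (induction r)
  case (LVar n)
  then show ?case by (auto simp: union_closed_def)
next
  case (LMeet p q)
  then show ?case unfolding leaf_family.simps by (rule union_closed_image2) auto
next
  case (LJoin p q)
  then show ?case unfolding leaf_family.simps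
    by (rule union_closed_image2) (auto simp: cyl_Un, auto simp: cyl_def)
qed

lemma leaf_family_UNIV: "leaf_family r N \<subseteq> leaf_family r UNIV"
  by (induction r) (simp, (simp only: leaf_family.simps, blast)+)

text \<open>By construction the set of all points evaluates as \<open>r\<close> itself: under a meet it splits into the points
of the two sides, under a join it is a full cylinder over either side.\<close>

lemma points_in_family_eval: "points r \<in> family_eval (\<lambda>n. leaf_family r {n}) r"
proof (induction r)
  case (LVar n)
  then show ?case by simp
next
  case (LMeet p q)
  have e: "{} \<in> leaf_family r {n}" for r n using union_closed_leaf_family[of r] by (simp add: union_closed_def)
  have "PL ` points p \<in> family_eval (\<lambda>n. leaf_family (LMeet p q) {n}) p"
    by (rule family_eval_map[where h = "image PL", OF _ _ LMeet(1)]) (use e in auto)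
  moreover have "PR ` points q \<in> family_eval (\<lambda>n. leaf_family (LMeet p q) {n}) q"
    by (rule family_eval_map[where h = "image PR", OF _ _ LMeet(2)]) (use e in auto)
  ultimately show ?case by auto
next
  case (LJoin p q)
  have e: "{} \<in> leaf_family r {n}" for r n using union_closed_leaf_family[of r] by (simp add: union_closed_def)
  have "cyl p q (points p) {} \<in> family_eval (\<lambda>n. leaf_family (LJoin p q) {n}) p"
    by (rule family_eval_map[where h = "\<lambda>a. cyl p q a {}", OF _ _ LJoin(1)])
       (use e in \<open>auto simp: cyl_Un\<close>)
  moreover have "cyl p q {} (points q) \<in> family_eval (\<lambda>n. leaf_family (LJoin p q) {n}) q"
    by (rule family_eval_map[where h = "\<lambda>b. cyl p q {} b", OF _ _ LJoin(2)])
       (use e in \<open>auto simp: cyl_Un\<close>)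
  moreover have "cyl p q (points p) {} = points (LJoin p q)" "cyl p q {} (points q) = points (LJoin p q)"
    by (auto simp: cyl_def)
  ultimately show ?case by simp
qed

subsection \<open>Bounding families by a lattice\<close>

text \<open>\<open>bound L \<rho> r a x\<close> says that \<open>x\<close> is below a lattice element attached to \<open>a\<close>: for the empty set there is no
condition, for the full set the element is the value of \<open>r\<close>, and otherwise it is the meet of the
elements attached to the parts of \<open>a\<close> on the two sides. Using a relation avoids adding a top element
to \<open>L\<close>.\<close>

fun bound :: "'l gorder \<Rightarrow> (nat \<Rightarrow> 'l) \<Rightarrow> lat_tm \<Rightarrow> point set \<Rightarrow> 'l \<Rightarrow> bool" where
  "bound L \<rho> (LVar m) a x \<longleftrightarrow> a = {} \<or> x \<sqsubseteq>\<^bsub>L\<^esub> \<rho> m"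
| "bound L \<rho> (LMeet p q) a x \<longleftrightarrow> bound L \<rho> p (PL -` a) x \<and> bound L \<rho> q (PR -` a) x"
| "bound L \<rho> (LJoin p q) a x \<longleftrightarrow>
     (if a = points (LJoin p q) then x \<sqsubseteq>\<^bsub>L\<^esub> eval_lat L \<rho> (LJoin p q)
      else bound L \<rho> p {u. \<forall>v \<in> points q. PP u v \<in> a} x \<and> bound L \<rho> q {v. \<forall>u \<in> points p. PP u v \<in> a} x)"

text \<open>A proper cylinder union determines its two bases: a point outside one base detects the other.\<close>

lemma bound_cyl:
  assumes "a \<in> leaf_family p N" "b \<in> leaf_family q N"
  shows "bound L \<rho> (LJoin p q) (cyl p q a b) x \<longleftrightarrow>
     (if a = points p \<or> b = points q then x \<sqsubseteq>\<^bsub>L\<^esub> eval_lat L \<rho> (LJoin p q)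
      else bound L \<rho> p a x \<and> bound L \<rho> q b x)"
proof -
  have s: "a \<subseteq> points p" "b \<subseteq> points q"
    using assms union_closed_leaf_family[of p N] union_closed_leaf_family[of q N] by (auto simp: union_closed_def)
  have "{u. \<forall>v \<in> points q. PP u v \<in> cyl p q a b} = a" "{v. \<forall>u \<in> points p. PP u v \<in> cyl p q a b} = b"
    if "a \<noteq> points p" "b \<noteq> points q"
    using that s by (auto simp: cyl_def)
  then show ?thesis using cyl_full_iff[OF s] by (auto simp del: points.simps eval_lat.simps)
qed

lemma bound_image: "bound L \<rho> (LMeet p q) (PL ` a \<union> PR ` b) x \<longleftrightarrow> bound L \<rho> p a x \<and> bound L \<rho> q b x"
proof -
  have "PL -` (PL ` a \<union> PR ` b) = a" "PR -` (PL ` a \<union> PR ` b) = b" by auto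
  then show ?thesis by simp
qed

context
  fixes L :: "'l gorder" and \<rho> :: "nat \<Rightarrow> 'l"
  assumes L: "lattice L" and \<rho>: "range \<rho> \<subseteq> carrier L"
begin

interpretation L: lattice L by (rule L)

lemma eval_lat_carrier: "eval_lat L \<rho> r \<in> carrier L"
  by (induction r) (use \<rho> in auto)

lemma bound_down:
  assumes "y \<sqsubseteq>\<^bsub>L\<^esub> x" "x \<in> carrier L" "y \<in> carrier L"
  shows "bound L \<rho> r a x \<Longrightarrow> bound L \<rho> r a y"
proof (induction r arbitrary: a)
  case (LVar n)
  then show ?case using assms L.le_trans[of y x "\<rho> n"] \<rho> by (auto simp: image_subset_iff)
next
  case (LJoin p q)
  then show ?case
    using assms L.le_trans[of y x "eval_lat L \<rho> (LJoin p q)"] eval_lat_carrier[of "LJoin p q"]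
    by (auto simp del: points.simps eval_lat.simps split: if_splits)
qed auto

lemma bound_join:
  assumes "x \<in> carrier L" "y \<in> carrier L"
  shows "bound L \<rho> r a x \<Longrightarrow> bound L \<rho> r a y \<Longrightarrow> bound L \<rho> r a (x \<squnion>\<^bsub>L\<^esub> y)"
proof (induction r arbitrary: a)
  case (LVar n)
  then show ?case using assms L.join_le \<rho> by (auto simp: image_subset_iff)
next
  case (LJoin p q)
  then show ?case
    using assms L.join_le eval_lat_carrier[of "LJoin p q"]
    by (auto simp del: points.simps eval_lat.simps split: if_splits)
qed auto

lemma bound_points: "x \<in> carrier L \<Longrightarrow> bound L \<rho> r (points r) x \<longleftrightarrow> x \<sqsubseteq>\<^bsub>L\<^esub> eval_lat L \<rho> r"
proof (induction r)
  case (LMeet p q)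
  have "bound L \<rho> (LMeet p q) (points (LMeet p q)) x \<longleftrightarrow> x \<sqsubseteq>\<^bsub>L\<^esub> eval_lat L \<rho> p \<and> x \<sqsubseteq>\<^bsub>L\<^esub> eval_lat L \<rho> q"
    using LMeet by (simp only: points.simps bound_image)
  also have "\<dots> \<longleftrightarrow> x \<sqsubseteq>\<^bsub>L\<^esub> eval_lat L \<rho> p \<sqinter>\<^bsub>L\<^esub> eval_lat L \<rho> q"
    using LMeet.prems eval_lat_carrier
    by (meson L.le_trans L.meet_closed L.meet_le L.meet_left L.meet_right)
  finally show ?case by simp
qed auto

lemma le_eval_LJoin:
  assumes "x \<in> carrier L" "x \<sqsubseteq>\<^bsub>L\<^esub> eval_lat L \<rho> p \<or> x \<sqsubseteq>\<^bsub>L\<^esub> eval_lat L \<rho> q"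
  shows "x \<sqsubseteq>\<^bsub>L\<^esub> eval_lat L \<rho> (LJoin p q)"
  using assms eval_lat_carrier L.join_left L.join_right L.join_closed L.le_trans
  by (metis eval_lat.simps(2))

text \<open>The one critical case, under a join, is a union of two sets, neither of which is full, that becomes full. Then the
bases on one side, say that of \<open>p\<close>, cover it; by induction \<open>x\<close> is below the value of \<open>p\<close>, hence below
the join.\<close>

lemma bound_Un:
  assumes x: "x \<in> carrier L"
  shows "a \<in> leaf_family r UNIV \<Longrightarrow> b \<in> leaf_family r UNIV \<Longrightarrow> bound L \<rho> r a x \<Longrightarrow> bound L \<rho> r b x
    \<Longrightarrow> bound L \<rho> r (a \<union> b) x"
proof (induction r arbitrary: a b)
  case (LVar n)
  then show ?case by auto
next
  case (LMeet p q)
  obtain a1 a2 b1 b2 where ab: "a = PL ` a1 \<union> PR ` a2" "b = PL ` b1 \<union> PR ` b2"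
    "a1 \<in> leaf_family p UNIV" "b1 \<in> leaf_family p UNIV" "a2 \<in> leaf_family q UNIV" "b2 \<in> leaf_family q UNIV"
    using LMeet.prems(1,2) by auto
  have "a \<union> b = PL ` (a1 \<union> b1) \<union> PR ` (a2 \<union> b2)" using ab by blast
  then show ?case using LMeet.IH LMeet.prems(3,4) ab by (simp only: bound_image)
next
  case (LJoin p q)
  obtain a1 a2 b1 b2 where ab: "a = cyl p q a1 a2" "b = cyl p q b1 b2"
    "a1 \<in> leaf_family p UNIV" "b1 \<in> leaf_family p UNIV" "a2 \<in> leaf_family q UNIV" "b2 \<in> leaf_family q UNIV"
    using LJoin.prems(1,2) by auto
  have u: "a1 \<union> b1 \<in> leaf_family p UNIV" "a2 \<union> b2 \<in> leaf_family q UNIV"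
    and s: "a1 \<subseteq> points p" "b1 \<subseteq> points p" "a2 \<subseteq> points q" "b2 \<subseteq> points q"
    using ab union_closed_leaf_family[of p UNIV] union_closed_leaf_family[of q UNIV] by (auto simp: union_closed_def)
  note A = LJoin.prems(3)[unfolded ab(1) bound_cyl[OF ab(3,5)]]
  note B = LJoin.prems(4)[unfolded ab(2) bound_cyl[OF ab(4,6)]]
  show ?case
  proof (cases "(a1 = points p \<or> a2 = points q) \<or> (b1 = points p \<or> b2 = points q)")
    case True
    then have "x \<sqsubseteq>\<^bsub>L\<^esub> eval_lat L \<rho> (LJoin p q)" using A B by (auto split: if_splits)
    moreover have "a1 \<union> b1 = points p \<or> a2 \<union> b2 = points q" using True s by auto
    ultimately show ?thesis unfolding ab(1,2) cyl_Un bound_cyl[OF u] by simp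
  next
    case False
    then have "bound L \<rho> p (a1 \<union> b1) x" "bound L \<rho> q (a2 \<union> b2) x"
      using A B LJoin.IH ab by auto
    then show ?thesis unfolding ab(1,2) cyl_Un bound_cyl[OF u]
      using bound_points[OF x] le_eval_LJoin[OF x] by auto
  qed
qed

lemma bound_var: "a \<in> leaf_family r {n} \<Longrightarrow> bound L \<rho> r a (\<rho> n)"
proof (induction r arbitrary: a)
  case (LVar m)
  then show ?case using \<rho> by (auto split: if_splits)
next
  case (LMeet p q)
  then show ?case by (auto simp: bound_image simp del: bound.simps)
next
  case (LJoin p q)
  then obtain a1 a2 where a: "a = cyl p q a1 a2" "a1 \<in> leaf_family p {n}" "a2 \<in> leaf_family q {n}" by auto
  have x: "\<rho> n \<in> carrier L" using \<rho> by auto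
  have "bound L \<rho> p a1 (\<rho> n)" "bound L \<rho> q a2 (\<rho> n)" using a LJoin.IH by auto
  then show ?case unfolding a(1) bound_cyl[OF a(2,3)]
    using bound_points[OF x] le_eval_LJoin[OF x] by auto
qed

text \<open>Each rule of evaluation respects the bound: intersection by \<open>bound_join\<close>, pairwise union by
\<open>bound_Un\<close>, and generators by \<open>bound_var\<close>.\<close>

lemma bound_family_eval:
  "a \<in> family_eval (\<lambda>n. leaf_family r {n}) s \<Longrightarrow> a \<in> leaf_family r UNIV \<and> bound L \<rho> r a (eval_lat L \<rho> s)"
proof (induction s arbitrary: a)
  case (LVar n)
  then show ?case using bound_var[of a r n] leaf_family_UNIV[of r "{n}"] by auto
next
  case (LJoin p q)
  then show ?case using bound_join eval_lat_carrier by simp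
next
  case (LMeet p q)
  obtain b c where bc: "a = b \<union> c" "b \<in> family_eval (\<lambda>n. leaf_family r {n}) p" "c \<in> family_eval (\<lambda>n. leaf_family r {n}) q"
    using LMeet.prems by auto
  have m: "bound L \<rho> r b (eval_lat L \<rho> (LMeet p q))" "bound L \<rho> r c (eval_lat L \<rho> (LMeet p q))"
    using LMeet.IH bc eval_lat_carrier L.meet_left L.meet_right L.meet_closed bound_down
    by (metis eval_lat.simps(3))+
  have f: "b \<in> leaf_family r UNIV" "c \<in> leaf_family r UNIV" using LMeet.IH bc by auto
  have "b \<union> c \<in> leaf_family r UNIV" using union_closed_leaf_family[of r UNIV] f by (auto simp: union_closed_def)
  then show ?case using bound_Un[OF eval_lat_carrier f m] bc(1) by blast
qed

lemma points_notin_family_eval: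
  assumes "\<not> eval_lat L \<rho> s \<sqsubseteq>\<^bsub>L\<^esub> eval_lat L \<rho> r"
  shows "points r \<notin> family_eval (\<lambda>n. leaf_family r {n}) s"
  using bound_family_eval[of "points r" r s] bound_points[OF eval_lat_carrier] assms by blast

end

subsection \<open>From families to semilattice congruences\<close>

definition sep :: "'x set \<Rightarrow> 'x set set \<Rightarrow> ('x set \<times> 'x set) set" where
  "sep X F = {(s, t). s \<subseteq> X \<and> t \<subseteq> X \<and> (\<forall>Y \<in> F. Y \<subseteq> s \<longleftrightarrow> Y \<subseteq> t)}"

text \<open>The interior of \<open>s\<close>: its largest subset in \<open>F\<close>, if \<open>F\<close> is a union-closed family on a finite set.\<close>

definition core :: "'x set set \<Rightarrow> 'x set \<Rightarrow> 'x set" where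
  "core F s = \<Union>{Y \<in> F. Y \<subseteq> s}"

lemma core_sub: "core F s \<subseteq> s"
  by (auto simp: core_def)

lemma core_in:
  assumes "finite X" "union_closed X F"
  shows "core F s \<in> F"
proof -
  have "\<Union>G \<in> F" if "finite G" "G \<subseteq> F" for G
    using that by induction (use assms(2) in \<open>auto simp: union_closed_def\<close>)
  moreover have "finite {Y \<in> F. Y \<subseteq> s}"
    by (rule finite_subset[of _ "Pow X"]) (use assms in \<open>auto simp: union_closed_def\<close>)
  ultimately show ?thesis unfolding core_def by simp
qed

lemma sep_core: "s \<subseteq> X \<Longrightarrow> (s, core F s) \<in> sep X F"
  using core_sub[of F s] by (auto simp: sep_def core_def)

text \<open>Taking interiors for \<open>F\<close> and for \<open>G\<close> in turn shrinks \<open>s\<close> until it is a member of both families.\<close>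

lemma sep_Int_core:
  assumes X: "finite X" and F: "union_closed X F" and G: "union_closed X G"
  shows "s \<subseteq> X \<Longrightarrow> (s, core (F \<inter> G) s) \<in> (sep X F \<union> sep X G)\<^sup>*"
proof (induction "card s" arbitrary: s rule: less_induct)
  case less
  have fin: "finite s" using less.prems X by (rule finite_subset)
  show ?case
  proof (cases "core F s = s \<and> core G s = s")
    case True
    then have "s \<in> F \<inter> G" using core_in[OF X F] core_in[OF X G] by (metis IntI)
    then have "core (F \<inter> G) s = s" by (auto simp: core_def)
    then show ?thesis by simp
  next
    case False
    then obtain H where H: "H = F \<or> H = G" "core H s \<noteq> s" by blast
    have sub: "core H s \<subseteq> X" using core_sub[of H s] less.prems by simp
    have "card (core H s) < card s"
      using H(2) core_sub[of H s] fin by (intro psubset_card_mono) auto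
    then have "(core H s, core (F \<inter> G) (core H s)) \<in> (sep X F \<union> sep X G)\<^sup>*"
      using sub by (rule less.hyps)
    moreover have "core (F \<inter> G) (core H s) = core (F \<inter> G) s"
    proof -
      have "{Y \<in> F \<inter> G. Y \<subseteq> core H s} = {Y \<in> F \<inter> G. Y \<subseteq> s}"
        using H(1) core_sub[of H s] by (auto simp: core_def)
      then show ?thesis unfolding core_def[of "F \<inter> G"] by simp
    qed
    moreover have "(s, core H s) \<in> sep X F \<union> sep X G" using sep_core[OF less.prems, of H] H(1) by auto
    ultimately show ?thesis by (metis converse_rtrancl_into_rtrancl)
  qed
qed

lemma sep_Int:
  assumes "finite X" "union_closed X F" "union_closed X G"
  shows "sep X (F \<inter> G) \<subseteq> (sep X F \<union> sep X G)\<^sup>*"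
proof clarify
  fix s t assume st: "(s, t) \<in> sep X (F \<inter> G)"
  then have "{Y \<in> F \<inter> G. Y \<subseteq> s} = {Y \<in> F \<inter> G. Y \<subseteq> t}" by (auto simp: sep_def)
  then have "core (F \<inter> G) s = core (F \<inter> G) t" by (simp add: core_def)
  moreover have "sym ((sep X F \<union> sep X G)\<^sup>*)"
    by (rule sym_rtrancl) (auto simp: sep_def sym_def)
  ultimately show "(s, t) \<in> (sep X F \<union> sep X G)\<^sup>*"
    using sep_Int_core[OF assms, of s] sep_Int_core[OF assms, of t] st
    by (metis (no_types, lifting) case_prodD mem_Collect_eq rtrancl_trans sep_def symD)
qed

lemma sep_refl: "s \<subseteq> X \<Longrightarrow> (s, s) \<in> sep X F"
  by (simp add: sep_def)

lemma sep_sym: "(s, t) \<in> sep X F \<Longrightarrow> (t, s) \<in> sep X F"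
  by (simp add: sep_def)

lemma sep_trans: "(s, t) \<in> sep X F \<Longrightarrow> (t, u) \<in> sep X F \<Longrightarrow> (s, u) \<in> sep X F"
  by (simp add: sep_def)

lemma sep_antimono: "F \<subseteq> G \<Longrightarrow> sep X G \<subseteq> sep X F"
  by (auto simp: sep_def)

lemma sep_Un:
  assumes "union_closed X F" "union_closed X G"
  shows "sep X {a \<union> b | a b. a \<in> F \<and> b \<in> G} = sep X F \<inter> sep X G"
proof
  have e: "{} \<in> F" "{} \<in> G" using assms by (auto simp: union_closed_def)
  have "F \<subseteq> {a \<union> b | a b. a \<in> F \<and> b \<in> G}"
    using e(2) by (metis (mono_tags, lifting) Un_empty_right mem_Collect_eq subsetI)
  moreover have "G \<subseteq> {a \<union> b | a b. a \<in> F \<and> b \<in> G}"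
    using e(1) by (metis (mono_tags, lifting) Un_empty_left mem_Collect_eq subsetI)
  ultimately show "sep X {a \<union> b | a b. a \<in> F \<and> b \<in> G} \<subseteq> sep X F \<inter> sep X G"
    by (intro Int_greatest sep_antimono)
  show "sep X F \<inter> sep X G \<subseteq> sep X {a \<union> b | a b. a \<in> F \<and> b \<in> G}"
    by (auto simp: sep_def)
qed

text \<open>The full set \<open>X\<close> and its interior for \<open>F\<close> look alike to \<open>F\<close>, but a family containing \<open>X\<close> tells them
apart.\<close>

lemma sep_strict:
  assumes "finite X" "union_closed X F" "X \<in> G" "X \<notin> F"
  shows "(X, core F X) \<in> sep X F" "(X, core F X) \<notin> sep X G"
proof -
  show "(X, core F X) \<in> sep X F" by (rule sep_core) simp
  have "core F X \<noteq> X" using core_in[OF assms(1,2), of X] assms(4) by auto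
  then show "(X, core F X) \<notin> sep X G" using assms(3) core_sub[of F X] by (auto simp: sep_def)
qed

section \<open>Lattice identities in the free algebra\<close>

lemma eval_lat_Con:
  assumes alg: "is_algebra ar A" and "\<And>n. congruence ar A (\<theta> n)"
  shows "congruence ar A (eval_lat (Con ar A) \<theta> r)"
proof (induction r)
  case (LVar n)
  then show ?case using assms(2) by simp
next
  case (LJoin p q)
  then show ?case by (simp add: join_Con[OF alg] congruence_join[OF alg])
next
  case (LMeet p q)
  then show ?case by (simp add: meet_Con congruence_Int)
qed

context m3_algebra
begin

abbreviation "Fr \<equiv> free_alg ar U"

abbreviation "cls \<equiv> term_class ar U"

context
  fixes X :: "'x set" and F :: "nat \<Rightarrow> 'x set set" and v :: "nat \<Rightarrow> 'x set"
  assumes X: "finite X" and F: "\<And>n. union_closed X (F n)" and v: "range v = Pow X"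
begin

text \<open>The labelling \<open>v\<close> exhausts the semilattice \<open>(\<PP>(X), \<inter>)\<close>; related labels generate a congruence of
the free algebra.\<close>

definition sep_cong :: "nat \<Rightarrow> (('f, nat) tm set \<times> ('f, nat) tm set) set" where
  "sep_cong n = var_cong ar U {(i, j). (v i, v j) \<in> sep X (F n)}"

lemma vX: "v i \<subseteq> X"
  using v by auto

lemma union_closed_eval: "union_closed X (family_eval F r)"
  by (rule union_closed_family_eval[OF F])

lemma eval_sep_cong: "congruence ar Fr (eval_lat (Con ar Fr) sep_cong r)"
  by (rule eval_lat_Con[OF is_algebra_free_alg]) (simp add: sep_cong_def congruence_var_cong)

lemma eval_sep_cong_join:
  "eval_lat (Con ar Fr) sep_cong (LJoin p q) =
     (eval_lat (Con ar Fr) sep_cong p \<union> eval_lat (Con ar Fr) sep_cong q)\<^sup>+"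
  by (simp add: join_Con is_algebra_free_alg eval_sep_cong)

lemma eval_sep_cong_meet:
  "eval_lat (Con ar Fr) sep_cong (LMeet p q) =
     eval_lat (Con ar Fr) sep_cong p \<inter> eval_lat (Con ar Fr) sep_cong q"
  by (simp add: meet_Con eval_sep_cong)

text \<open>Each element of a chain in the semilattice is the label of a variable, so a chain witnessing a join
of semilattice congruences lifts to the free algebra.\<close>

lemma Var_in_eval_if_sep:
  "(v i, v j) \<in> sep X (family_eval F r) \<Longrightarrow> (cls (Var i), cls (Var j)) \<in> eval_lat (Con ar Fr) sep_cong r"
proof (induction r arbitrary: i j)
  case (LVar n)
  then show ?case by (simp add: sep_cong_def var_cong_Var)
next
  case (LMeet p q)
  then show ?case using sep_Un[OF union_closed_eval union_closed_eval, of p q] unfolding eval_sep_cong_meet by auto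
next
  case (LJoin p q)
  let ?R = "eval_lat (Con ar Fr) sep_cong p \<union> eval_lat (Con ar Fr) sep_cong q"
  have step: "(cls (Var i), cls (Var j)) \<in> ?R"
    if "(v i, v j) \<in> sep X (family_eval F p) \<union> sep X (family_eval F q)" for i j
    using that LJoin.IH by blast
  have "(cls (Var i), cls (Var j)) \<in> ?R\<^sup>+"
    if "(v i, t) \<in> (sep X (family_eval F p) \<union> sep X (family_eval F q))\<^sup>*" "v j = t" for i j t
    using that
  proof (induction arbitrary: j)
    case base
    then show ?case using step[of i j] sep_refl[OF vX] by auto
  next
    case (step s t)
    \<comment> \<open>name the intermediate element by a variable\<close>
    have "s \<in> range v" using step.hyps(2) unfolding v by (auto simp: sep_def)
    then obtain k where "v k = s" by auto
    then show ?case using step.IH[of k] step.hyps(2) step.prems LJoin.IH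
      by (metis (no_types, lifting) Un_iff trancl.trancl_into_trancl)
  qed
  then show ?case
    using LJoin.prems sep_Int[OF X union_closed_eval[of p] union_closed_eval[of q]] unfolding eval_sep_cong_join by auto
qed

text \<open>The map from idempotent terms to the semilattice: terms are read as meets of the labels of their
essential variables.\<close>

definition vars_meet :: "('f, nat) tm \<Rightarrow> 'x set" where
  "vars_meet t = {x \<in> X. \<forall>k \<in> essential_vars t. x \<in> v k}"

text \<open>The pairs whose images under \<open>vars_meet\<close> are related. Nothing is asked of pairs of non-idempotent
terms, on which \<open>essential_vars_rename\<close> says nothing.\<close>

definition cong_bound :: "'x set set \<Rightarrow> (('f, nat) tm set \<times> ('f, nat) tm set) set" where
  "cong_bound G = {(c, d). c \<in> carrier Fr \<and> d \<in> carrier Fr \<and>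
     (idem_term (term_rep c) \<longleftrightarrow> idem_term (term_rep d)) \<and>
     (idem_term (term_rep c) \<longrightarrow> (vars_meet (term_rep c), vars_meet (term_rep d)) \<in> sep X G)}"

lemma cong_bound_antimono: "G \<subseteq> H \<Longrightarrow> cong_bound H \<subseteq> cong_bound G"
  by (auto simp: cong_bound_def subsetD[OF sep_antimono])

lemma trans_cong_bound: "trans (cong_bound G)"
proof (rule transI)
  fix c d e assume h: "(c, d) \<in> cong_bound G" "(d, e) \<in> cong_bound G"
  have "(vars_meet (term_rep c), vars_meet (term_rep e)) \<in> sep X G" if "idem_term (term_rep c)"
    using h that by (auto simp: cong_bound_def sep_def)
  then show "(c, e) \<in> cong_bound G" using h by (simp add: cong_bound_def)
qed

lemma subset_vars_meet: "Y \<subseteq> vars_meet t \<longleftrightarrow> Y \<subseteq> X \<and> (\<forall>k \<in> essential_vars t. Y \<subseteq> v k)"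
  by (auto simp: vars_meet_def)

lemma term_eq_idem_term: "(s, t) \<in> term_eq ar U \<Longrightarrow> idem_term s \<longleftrightarrow> idem_term t"
  by (auto simp: term_eq_def idem_term_def image_subset_iff)

lemma term_eq_essential_vars: "(s, t) \<in> term_eq ar U \<Longrightarrow> essential_vars s = essential_vars t"
  by (rule essential_vars_cong) (simp add: term_eq_def)

text \<open>Send each variable to the least variable with a related label. Related terms become equal under this
renaming, so the images of their essential variables coincide, and members of \<open>F n\<close> cannot
distinguish a label from that of its representative.\<close>

lemma sep_cong_bound: "sep_cong n \<subseteq> cong_bound (F n)"
proof
  fix p assume p: "p \<in> sep_cong n"
  obtain c d where cd: "p = (c, d)" by (cases p)
  have C: "c \<in> carrier Fr" "d \<in> carrier Fr"
    using p cd congruence_sub[OF congruence_var_cong] by (auto simp: sep_cong_def)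
  define s t where "s = term_rep c" and "t = term_rep d"
  have w: "wf_tm ar s" "wf_tm ar t" "cls s = c" "cls t = d"
    using C term_rep_carrier[of _ ar U] by (simp_all add: s_def t_def)
  define \<sigma> where "\<sigma> i = (LEAST j. (v i, v j) \<in> sep X (F n))" for i
  have \<sigma>: "(v i, v (\<sigma> i)) \<in> sep X (F n)" for i
    unfolding \<sigma>_def by (rule LeastI[of _ i]) (rule sep_refl[OF vX])
  have "\<sigma> i = \<sigma> j" if "(i, j) \<in> {(i, j). (v i, v j) \<in> sep X (F n)}" for i j
  proof -
    have "(v i, v k) \<in> sep X (F n) \<longleftrightarrow> (v j, v k) \<in> sep X (F n)" for k
      using that sep_sym sep_trans by blast
    then show ?thesis by (simp add: \<sigma>_def)
  qed
  then have r: "(rename \<sigma> s, rename \<sigma> t) \<in> term_eq ar U"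
    using p w by (intro var_cong_rename[OF alg]) (auto simp: cd sep_cong_def)
  have i: "idem_term s \<longleftrightarrow> idem_term t" using term_eq_idem_term[OF r] by (simp add: idem_term_rename)
  have "(vars_meet s, vars_meet t) \<in> sep X (F n)" if "idem_term s"
  proof -
    have e: "\<sigma> ` essential_vars s = \<sigma> ` essential_vars t"
      using term_eq_essential_vars[OF r] essential_vars_rename[OF w(1), of \<sigma>] essential_vars_rename[OF w(2), of \<sigma>] that i by simp
    have "Y \<subseteq> vars_meet s \<longleftrightarrow> Y \<subseteq> vars_meet t" if "Y \<in> F n" for Y
    proof -
      have "Y \<subseteq> v k \<longleftrightarrow> Y \<subseteq> v (\<sigma> k)" for k using \<sigma>[of k] that by (auto simp: sep_def)
      then have im: "Y \<subseteq> vars_meet u \<longleftrightarrow> Y \<subseteq> X \<and> (\<forall>k \<in> \<sigma> ` essential_vars u. Y \<subseteq> v k)" for u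
        by (simp add: subset_vars_meet)
      show ?thesis by (simp only: im e)
    qed
    then show ?thesis by (auto simp: sep_def vars_meet_def)
  qed
  then show "p \<in> cong_bound (F n)" using C i by (simp add: cd cong_bound_def s_def t_def)
qed

lemma eval_sub_cong_bound: "eval_lat (Con ar Fr) sep_cong r \<subseteq> cong_bound (family_eval F r)"
proof (induction r)
  case (LVar n)
  then show ?case using sep_cong_bound by simp
next
  case (LMeet p q)
  have "cong_bound (family_eval F p) \<inter> cong_bound (family_eval F q) \<subseteq> cong_bound (family_eval F (LMeet p q))"
    using sep_Un[OF union_closed_eval union_closed_eval, of p q] by (auto simp: cong_bound_def)
  then show ?case using LMeet unfolding eval_sep_cong_meet by blast
next
  case (LJoin p q)
  let ?S = "cong_bound (family_eval F (LJoin p q))"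
  let ?R = "eval_lat (Con ar Fr) sep_cong p \<union> eval_lat (Con ar Fr) sep_cong q"
  have "?R \<subseteq> ?S"
    using LJoin cong_bound_antimono[of "family_eval F (LJoin p q)"] by fastforce
  then show ?case
    using trancl_id[OF trans_cong_bound, of "family_eval F (LJoin p q)"] trancl_mono[of _ ?R ?S] unfolding eval_sep_cong_join by auto
qed

lemma sep_if_Var_in_eval:
  assumes "(cls (Var i), cls (Var j)) \<in> eval_lat (Con ar Fr) sep_cong r"
  shows "(v i, v j) \<in> sep X (family_eval F r)"
proof -
  have r: "(Var k, term_rep (cls (Var k))) \<in> term_eq ar U" for k by (rule term_rep) simp
  have "idem_term (term_rep (cls (Var k)))" "vars_meet (term_rep (cls (Var k))) = v k" for k
    using term_eq_idem_term[OF r, of k] idem_term_Var[of k] term_eq_essential_vars[OF r, of k] vX[of k]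
    by (auto simp: essential_vars_Var vars_meet_def)
  then show ?thesis using eval_sub_cong_bound[of r] assms by (auto simp: cong_bound_def)
qed

text \<open>Every semilattice congruence obtained from the generators by a lattice term is visible on the
variables of the free algebra.\<close>

lemma sep_represented:
  "\<exists>\<theta>. (\<forall>n. congruence ar Fr (\<theta> n)) \<and>
     (\<forall>r i j. (cls (Var i), cls (Var j)) \<in> eval_lat (Con ar Fr) \<theta> r \<longleftrightarrow> (v i, v j) \<in> sep X (family_eval F r))"
  using Var_in_eval_if_sep sep_if_Var_in_eval by (intro exI[of _ sep_cong]) (auto simp: sep_cong_def congruence_var_cong)

end

lemma lattice_inequality_fails:
  assumes L: "lattice L" and \<rho>: "range \<rho> \<subseteq> carrier L"
    and fails: "\<not> eval_lat L \<rho> p \<sqsubseteq>\<^bsub>L\<^esub> eval_lat L \<rho> q"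
  obtains \<theta> where "\<And>n. congruence ar Fr (\<theta> n)"
    "eval_lat (Con ar Fr) \<theta> p \<noteq> eval_lat (Con ar Fr) \<theta> q"
proof -
  let ?X = "points q" and ?F = "\<lambda>n. leaf_family q {n}"
  have X: "finite ?X" and F: "\<And>n. union_closed ?X (?F n)"
    by (auto intro: finite_points union_closed_leaf_family)
  obtain v :: "nat \<Rightarrow> point set" where v: "range v = Pow ?X"
  proof -
    obtain f and n :: nat where f: "Pow ?X = f ` {i. i < n}"
      using X finite_imp_nat_seg_image_inj_on[of "Pow ?X"] by auto
    have "range (\<lambda>i. if i < n then f i else ?X) = Pow ?X"
      using f by (auto simp: image_iff split: if_splits)
    then show thesis by (rule that)
  qed
  have uc': "union_closed ?X (family_eval ?F r)" for r by (rule union_closed_family_eval[OF F])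
  have strict: "(?X, core (family_eval ?F p) ?X) \<in> sep ?X (family_eval ?F p)"
    "(?X, core (family_eval ?F p) ?X) \<notin> sep ?X (family_eval ?F q)"
    using sep_strict[OF X uc' points_in_family_eval points_notin_family_eval[OF L \<rho> fails]] by auto
  obtain i j where ij: "v i = ?X" "v j = core (family_eval ?F p) ?X"
    using v core_sub[of "family_eval ?F p" ?X] by (metis Pow_iff Pow_top imageE)
  obtain \<theta> where \<theta>: "\<And>n. congruence ar Fr (\<theta> n)"
    "\<And>r i j. (cls (Var i), cls (Var j)) \<in> eval_lat (Con ar Fr) \<theta> r \<longleftrightarrow>
        (v i, v j) \<in> sep ?X (family_eval ?F r)"
    using sep_represented[where F = ?F, OF X F v] by blast
  have "eval_lat (Con ar Fr) \<theta> p \<noteq> eval_lat (Con ar Fr) \<theta> q"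
    using \<theta>(2)[of i j] strict ij by metis
  then show thesis by (rule that[OF \<theta>(1)])
qed

text \<open>Were the identity false in \<open>L\<close>, one of its two inequalities would fail, and the free algebra would
violate the identity.\<close>

theorem congruence_identity_trivial:
  assumes U: "U \<in> in_variety ar E" and E: "E \<subseteq> identities ar"
    and ci: "congruence_identity_of ar E p q" and L: "lattice L"
  shows "lattice_identity_holds L p q"
proof -
  have *: "eval_lat (Con ar Fr) \<theta> p = eval_lat (Con ar Fr) \<theta> q" if "\<And>n. congruence ar Fr (\<theta> n)" for \<theta>
    using ci free_alg_in_variety[OF U E] that
    by (auto simp: congruence_identity_of_def lattice_identity_holds_def image_subset_iff)
  show ?thesis unfolding lattice_identity_holds_def
  proof (intro allI impI)
    fix \<rho> :: "nat \<Rightarrow> _" assume \<rho>: "range \<rho> \<subseteq> carrier L"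
    interpret lattice L by (rule L)
    show "eval_lat L \<rho> p = eval_lat L \<rho> q"
    proof (rule le_antisym)
      show "eval_lat L \<rho> p \<sqsubseteq>\<^bsub>L\<^esub> eval_lat L \<rho> q"
        using lattice_inequality_fails[OF L \<rho>, of p q] * by metis
      show "eval_lat L \<rho> q \<sqsubseteq>\<^bsub>L\<^esub> eval_lat L \<rho> p"
        using lattice_inequality_fails[OF L \<rho>, of q p] * by metis
    qed (rule eval_lat_carrier[OF L \<rho>])+
  qed
qed

end

section \<open>Embedding \<open>M\<^sub>3\<close>\<close>

lemma M3_simps [simp]:
  "carrier M3 = UNIV" "x \<sqsubseteq>\<^bsub>M3\<^esub> y \<longleftrightarrow> x = y \<or> x = M3_bot \<or> y = M3_top"
  by (simp_all add: M3_def)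

lemma m3_comparable_or_atoms:
  "x \<sqsubseteq>\<^bsub>M3\<^esub> y \<or> y \<sqsubseteq>\<^bsub>M3\<^esub> x \<or> (\<exists>i j. i \<noteq> j \<and> x = M3_atom i \<and> y = M3_atom j)"
  by (cases x; cases y) auto

lemma partial_order_M3: "partial_order M3"
  by unfold_locales (auto simp: M3_def)

definition m3_join :: "m3 \<Rightarrow> m3 \<Rightarrow> m3" where
  "m3_join x y = (if x \<sqsubseteq>\<^bsub>M3\<^esub> y then y else if y \<sqsubseteq>\<^bsub>M3\<^esub> x then x else M3_top)"

definition m3_meet :: "m3 \<Rightarrow> m3 \<Rightarrow> m3" where
  "m3_meet x y = (if x \<sqsubseteq>\<^bsub>M3\<^esub> y then x else if y \<sqsubseteq>\<^bsub>M3\<^esub> x then y else M3_bot)"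

lemma least_m3_join: "least M3 (m3_join x y) (Upper M3 {x, y})"
  by (auto simp: least_def Upper_def m3_join_def)

lemma greatest_m3_meet: "greatest M3 (m3_meet x y) (Lower M3 {x, y})"
  by (auto simp: greatest_def Lower_def m3_meet_def)

lemma lattice_M3: "lattice M3"
proof -
  interpret partial_order M3 by (rule partial_order_M3)
  show ?thesis by unfold_locales (use least_m3_join greatest_m3_meet in blast)+
qed

lemma join_M3: "x \<squnion>\<^bsub>M3\<^esub> y = m3_join x y"
proof -
  interpret partial_order M3 by (rule partial_order_M3)
  show ?thesis unfolding join_def sup_def
    using least_m3_join by (intro some_equality least_unique)
qed

lemma meet_M3: "x \<sqinter>\<^bsub>M3\<^esub> y = m3_meet x y"
proof -
  interpret partial_order M3 by (rule partial_order_M3)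
  show ?thesis unfolding meet_def inf_def
    using greatest_m3_meet by (intro some_equality greatest_unique)
qed

lemma bottom_M3: "\<bottom>\<^bsub>M3\<^esub> = M3_bot"
  unfolding bottom_def by (intro some_equality) (auto simp: least_def)

lemma top_M3: "\<top>\<^bsub>M3\<^esub> = M3_top"
  unfolding top_def by (intro some_equality) (auto simp: greatest_def dest: spec[of _ M3_top])

lemma congruence_Id: "is_algebra ar A \<Longrightarrow> congruence ar A (Id_on (carrier A))"
proof (rule congruenceI_translations)
  assume A: "is_algebra ar A"
  show "equiv (carrier A) (Id_on (carrier A))"
    by (rule equivI) (auto simp: refl_on_def sym_def trans_def)
  fix f us x y vs
  assume "(x, y) \<in> Id_on (carrier A)" "set us \<subseteq> carrier A" "set vs \<subseteq> carrier A"
    "Suc (length us + length vs) = ar f"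
  then show "(opn A f (us @ x # vs), opn A f (us @ y # vs)) \<in> Id_on (carrier A)"
    by (auto intro!: opn_closed[OF A] Id_onI)
qed

lemma bottom_Con:
  assumes "is_algebra ar A"
  shows "\<bottom>\<^bsub>Con ar A\<^esub> = Id_on (carrier A)"
proof -
  interpret partial_order "Con ar A" by (rule partial_order_Con)
  have "Id_on (carrier A) \<subseteq> \<theta>" if "congruence ar A \<theta>" for \<theta>
    using congruence_refl[OF that] by (auto simp: Id_on_def)
  then have "least (Con ar A) (Id_on (carrier A)) (carrier (Con ar A))"
    using congruence_Id[OF assms] by (auto simp only: least_def Con_simps mem_Collect_eq)
  then show ?thesis unfolding bottom_def by (intro some_equality least_unique)
qed

lemma top_Con:
  assumes "is_algebra ar A"
  shows "\<top>\<^bsub>Con ar A\<^esub> = carrier A \<times> carrier A"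
proof -
  interpret partial_order "Con ar A" by (rule partial_order_Con)
  have "greatest (Con ar A) (carrier A \<times> carrier A) (carrier (Con ar A))"
    using congruence_full[OF assms] congruence_sub
    by (auto simp only: greatest_def Con_simps mem_Collect_eq)
  then show ?thesis unfolding top_def by (intro some_equality greatest_unique)
qed

context m3_algebra
begin

lemma nontrivial: "\<exists>x \<in> carrier U. \<exists>y \<in> carrier U. x \<noteq> y"
proof -
  obtain x y where "x \<in> carrier U" "x \<notin> A0" "y \<in> A0"
    using proper A0_sub sub_A0 by (auto simp: is_algebra_def)
  then show ?thesis using A0_sub by (intro bexI[of _ x] bexI[of _ y]) auto
qed

fun m3_cong :: "m3 \<Rightarrow> ('a \<times> 'a) set" where
  "m3_cong M3_bot = Id_on (carrier U)"
| "m3_cong (M3_atom k) = g k"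
| "m3_cong M3_top = carrier U \<times> carrier U"

lemma congruence_m3: "congruence ar U (m3_cong x)"
  by (cases x) (auto simp: congruence_Id[OF alg] cong_g congruence_full[OF alg])

lemma m3_cong_mono: "x \<sqsubseteq>\<^bsub>M3\<^esub> y \<Longrightarrow> m3_cong x \<subseteq> m3_cong y"
  using congruence_refl[OF congruence_m3[of y]] congruence_sub[OF congruence_m3[of x]] by auto

text \<open>If \<open>g i\<close> were inside \<open>g j\<close>, it would be trivial by the meets, hence inside all three; by the joins the
other two would then be full, against their trivial meet.\<close>

lemma m3_cong_incomparable:
  assumes "i \<noteq> j"
  shows "\<not> g i \<subseteq> g j"
proof
  assume sub: "g i \<subseteq> g j"
  have full: "carrier U \<times> carrier U \<subseteq> g k" if "g i \<subseteq> g k" "i \<noteq> k" for k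
  proof -
    have "(x, y) \<in> g k" if "(x, y) \<in> (g i \<union> g k)\<^sup>*" "x \<in> carrier U" for x y
      using that by induction (use \<open>g i \<subseteq> g k\<close> g_refl g_trans in blast)+
    then show ?thesis using join_g[OF that(2)] by blast
  qed
  have i: "g i \<subseteq> Id" using sub meet_g[OF assms] by blast
  obtain k where k: "k \<noteq> i" "k \<noteq> j"
    by (cases i; cases j) (auto intro: that[of I0] that[of I1] that[of I2])
  have "g i \<subseteq> g k" using i g_refl g_C by fastforce
  then have "carrier U \<times> carrier U \<subseteq> g k \<inter> g j" using full sub assms k by auto
  then show False using meet_g[OF k(2)] nontrivial by blast
qed

lemma m3_cong_order: "m3_cong x \<subseteq> m3_cong y \<longleftrightarrow> x \<sqsubseteq>\<^bsub>M3\<^esub> y"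
proof
  assume sub: "m3_cong x \<subseteq> m3_cong y"
  have top: "\<not> carrier U \<times> carrier U \<subseteq> g k" for k
  proof -
    obtain j where "j \<noteq> k" by (cases k) (auto intro: that[of I0] that[of I1])
    then show ?thesis using m3_cong_incomparable[of j k] congruence_sub[OF cong_g[of j]] by auto
  qed
  have bot: "\<not> g k \<subseteq> Id_on (carrier U)" for k
  proof -
    obtain j where "k \<noteq> j" by (cases k) (auto intro: that[of I0] that[of I1])
    then show ?thesis using m3_cong_incomparable[of k j] g_refl by blast
  qed
  have "\<not> carrier U \<times> carrier U \<subseteq> Id_on (carrier U)" using nontrivial by blast
  then show "x \<sqsubseteq>\<^bsub>M3\<^esub> y"
    using sub top bot m3_cong_incomparable by (cases x; cases y) auto
qed (rule m3_cong_mono)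

lemma m3_join_cong: "m3_cong x \<squnion>\<^bsub>Con ar U\<^esub> m3_cong y = m3_cong (m3_join x y)"
proof -
  have tr: "trans (m3_cong z)" for z
    using congruence_equiv[OF congruence_m3] by (simp add: equiv_def)
  have eq: "m3_cong x \<squnion>\<^bsub>Con ar U\<^esub> m3_cong y = (m3_cong x \<union> m3_cong y)\<^sup>+"
    by (rule join_Con[OF alg congruence_m3 congruence_m3])
  consider "x \<sqsubseteq>\<^bsub>M3\<^esub> y" | "y \<sqsubseteq>\<^bsub>M3\<^esub> x" | i j where "i \<noteq> j" "x = M3_atom i" "y = M3_atom j"
    using m3_comparable_or_atoms[of x y] by blast
  then show ?thesis
  proof cases
    case 1
    then show ?thesis
      using m3_cong_mono[OF 1] trancl_id[OF tr] unfolding eq by (auto simp: m3_join_def Un_absorb1)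
  next
    case 2
    then have "m3_join x y = x" by (auto simp: m3_join_def)
    then show ?thesis using m3_cong_mono[OF 2] trancl_id[OF tr] unfolding eq by (simp add: Un_absorb2)
  next
    case 3
    have "carrier U \<times> carrier U \<subseteq> (g i \<union> g j)\<^sup>+"
    proof clarify
      fix u w assume uw: "u \<in> carrier U" "w \<in> carrier U"
      then have "(u, w) \<in> (g i \<union> g j)\<^sup>*" using join_g[OF 3(1)] by blast
      then show "(u, w) \<in> (g i \<union> g j)\<^sup>+"
        using g_refl[OF uw(1), of i] by (auto simp: rtrancl_eq_or_trancl)
    qed
    moreover have "(g i \<union> g j)\<^sup>+ \<subseteq> carrier U \<times> carrier U"
      using congruence_sub[OF congruence_join[OF alg cong_g cong_g]] .
    ultimately show ?thesis using 3 unfolding eq by (auto simp: m3_join_def)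
  qed
qed

lemma m3_meet_cong: "m3_cong x \<sqinter>\<^bsub>Con ar U\<^esub> m3_cong y = m3_cong (m3_meet x y)"
proof -
  have eq: "m3_cong x \<sqinter>\<^bsub>Con ar U\<^esub> m3_cong y = m3_cong x \<inter> m3_cong y"
    by (rule meet_Con[OF congruence_m3 congruence_m3])
  consider "x \<sqsubseteq>\<^bsub>M3\<^esub> y" | "y \<sqsubseteq>\<^bsub>M3\<^esub> x" | i j where "i \<noteq> j" "x = M3_atom i" "y = M3_atom j"
    using m3_comparable_or_atoms[of x y] by blast
  then show ?thesis
  proof cases
    case 1
    then have "m3_meet x y = x" by (auto simp: m3_meet_def)
    then show ?thesis using m3_cong_mono[OF 1] unfolding eq by auto
  next
    case 2
    then have "m3_meet x y = y" by (auto simp: m3_meet_def)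
    then show ?thesis using m3_cong_mono[OF 2] unfolding eq by auto
  next
    case 3
    have "g i \<inter> g j = Id_on (carrier U)" using meet_g[OF 3(1)] g_refl g_C by blast
    then show ?thesis using 3 unfolding eq by (simp add: m3_meet_def)
  qed
qed

theorem M3_embeds: "zero_one_lattice_embedding M3 (Con ar U) m3_cong"
proof -
  interpret complete_lattice "Con ar U" by (rule complete_lattice_Con[OF alg])
  have "inj m3_cong"
  proof (rule injI)
    fix x y assume "m3_cong x = m3_cong y"
    then have "x \<sqsubseteq>\<^bsub>M3\<^esub> y" "y \<sqsubseteq>\<^bsub>M3\<^esub> x" using m3_cong_order by blast+
    then show "x = y" by auto
  qed
  then show ?thesis
    unfolding zero_one_lattice_embedding_def join_pres_def meet_pres_def
    by (auto simp: join_M3 meet_M3 m3_join_cong m3_meet_cong congruence_m3 bottom_M3 top_M3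
        bottom_Con[OF alg] top_Con[OF alg] lattice_M3 lattice_axioms)
qed

end

section \<open>Liftings of the bowtie diagram\<close>

subsection \<open>Subalgebras\<close>

lemma subalgebra_image:
  assumes "algebra_hom ar A B h" "is_algebra ar A"
  shows "subalgebra ar B (h ` carrier A)"
proof -
  have "opn B f ys \<in> h ` carrier A" if "length ys = ar f" "set ys \<subseteq> h ` carrier A" for f ys
  proof -
    define xs where "xs = map (inv_into (carrier A) h) ys"
    have "set xs \<subseteq> carrier A" "ys = map h xs"
      using that(2) by (auto simp: xs_def comp_def inv_into_into f_inv_into_f subset_iff
          intro!: map_idI[symmetric])
    then show ?thesis
      using assms that(1) by (auto simp: algebra_hom_def is_algebra_def intro!: rev_image_eqI)
  qed
  then show ?thesis using assms(2) by (auto simp: is_algebra_def)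
qed

lemma subalgebra_Inter:
  assumes "\<And>S. S \<in> \<S> \<Longrightarrow> subalgebra ar A S" "\<Inter>\<S> \<noteq> {}" "\<S> \<noteq> {}"
  shows "subalgebra ar A (\<Inter>\<S>)"
  using assms unfolding is_algebra_def by (simp add: le_Inf_iff)

lemma in_variety_subalgebra:
  assumes "A \<in> in_variety ar E" "subalgebra ar A S" "S \<subseteq> carrier A"
  shows "A\<lparr>carrier := S\<rparr> \<in> in_variety ar E"
  using assms unfolding in_variety_def satisfies_def by (auto simp: eval_carrier_update)

lemma congruence_restrict:
  assumes "congruence ar A \<theta>" "subalgebra ar A S" "S \<subseteq> carrier A"
  shows "congruence ar (A\<lparr>carrier := S\<rparr>) (\<theta> \<inter> S \<times> S)"
proof (rule congruenceI_translations[OF _ assms(2)])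
  show "equiv (carrier (A\<lparr>carrier := S\<rparr>)) (\<theta> \<inter> S \<times> S)"
  proof (rule equivI)
    show "refl_on (carrier (A\<lparr>carrier := S\<rparr>)) (\<theta> \<inter> S \<times> S)"
      using assms(3) congruence_refl[OF assms(1)] by (auto simp: refl_on_def)
    show "sym (\<theta> \<inter> S \<times> S)" using congruence_sym[OF assms(1)] by (auto simp: sym_def)
    show "trans (\<theta> \<inter> S \<times> S)" using congruence_trans[OF assms(1)] unfolding trans_def by blast
  qed auto
  fix f us x y vs
  assume h: "(x, y) \<in> \<theta> \<inter> S \<times> S" "set us \<subseteq> carrier (A\<lparr>carrier := S\<rparr>)"
    "set vs \<subseteq> carrier (A\<lparr>carrier := S\<rparr>)" "Suc (length us + length vs) = ar f"
  have "opn (A\<lparr>carrier := S\<rparr>) f (us @ z # vs) \<in> S" if "z \<in> S" for z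
    using opn_closed[OF assms(2), of "us @ z # vs" f] that h by simp
  moreover have "(opn A f (us @ x # vs), opn A f (us @ y # vs)) \<in> \<theta>"
    using h assms(3) by (intro congruence_translation[OF assms(1)]) auto
  ultimately show "(opn (A\<lparr>carrier := S\<rparr>) f (us @ x # vs), opn (A\<lparr>carrier := S\<rparr>) f (us @ y # vs)) \<in> \<theta> \<inter> S \<times> S"
    using h by auto
qed

subsection \<open>Congruences along a lifting\<close>

lemma bowtie_arr_mono: "X \<subseteq> Y \<Longrightarrow> bowtie_arr p q X \<subseteq> bowtie_arr p q Y"
proof -
  assume "X \<subseteq> Y"
  have fa: "from_atoms h Z \<subseteq> from_atoms h Z'" if "Z \<subseteq> Z'" for h and Z Z' :: "nat set"
    using that by (auto simp: from_atoms_def)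
  have f: "bt_f i Z \<subseteq> bt_f i Z'" and u: "bt_u i Z \<subseteq> bt_u i Z'" and e: "bt_e Z \<subseteq> bt_e Z'"
    if "Z \<subseteq> Z'" for i Z Z'
    using fa[OF that] by (cases i; simp add: bt_e_def)+
  show ?thesis
    by (cases "(p, q)" rule: bowtie_arr.cases)
       (simp_all add: \<open>X \<subseteq> Y\<close> f u e del: bt_f.simps bt_u.simps)
qed

fun three_nat :: "three \<Rightarrow> nat" where
  "three_nat I0 = 0" | "three_nat I1 = 1" | "three_nat I2 = 2"

lemma alg_lat_hom_mono:
  assumes "alg_lat_hom L M h" "x \<in> carrier L" "y \<in> carrier L" "x \<sqsubseteq>\<^bsub>L\<^esub> y"
  shows "h x \<sqsubseteq>\<^bsub>M\<^esub> h y"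
proof -
  have "isotone L M h"
    using assms(1) unfolding alg_lat_hom_def
    by (intro join_pres_isotone sup_pres_is_join_pres weak_sup_pres) auto
  then show ?thesis using assms by (simp add: use_iso1 isotone_def)
qed

text \<open>\<open>\<eta>\<close> is the natural equivalence between the congruence lattices and the diagram.\<close>

locale bowtie_lifting =
  fixes ar :: "'f \<Rightarrow> nat" and E and Ob :: "bowtie \<Rightarrow> ('f, 'a) algebra"
    and Arr :: "bowtie \<Rightarrow> bowtie \<Rightarrow> 'a \<Rightarrow> 'a" and \<eta>
  assumes diagram: "variety_diagram ar E Ob Arr"
    and iso: "alg_lat_iso (Con ar (Ob p)) (bowtie_ob p) (\<eta> p)"
    and natural: "p \<le> q \<Longrightarrow> congruence ar (Ob p) \<alpha> \<Longrightarrow>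
        \<eta> q (Con_map ar (Ob q) (Arr p q) \<alpha>) = bowtie_arr p q (\<eta> p \<alpha>)"
begin

abbreviation atoms :: "bowtie \<Rightarrow> nat set" where
  "atoms p \<equiv> {..<Suc (bt_level p)}"

lemma carrier_ob: "carrier (bowtie_ob p) = Pow (atoms p)" "le (bowtie_ob p) = (\<subseteq>)"
  by (simp_all add: bowtie_ob_def powerset_lattice_def)

lemma in_V: "Ob p \<in> in_variety ar E"
  using diagram by (simp add: variety_diagram_def)

lemma alg: "is_algebra ar (Ob p)"
  using in_V by (simp add: in_variety_def)

lemma hom: "p \<le> q \<Longrightarrow> algebra_hom ar (Ob p) (Ob q) (Arr p q)"
  using diagram by (simp add: variety_diagram_def)

lemma Arr_closed: "p \<le> q \<Longrightarrow> x \<in> carrier (Ob p) \<Longrightarrow> Arr p q x \<in> carrier (Ob q)"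
  using hom[of p q] by (auto simp: algebra_hom_def)

lemma Arr_comp: "p \<le> q \<Longrightarrow> q \<le> r \<Longrightarrow> x \<in> carrier (Ob p) \<Longrightarrow> Arr p r x = Arr q r (Arr p q x)"
  using diagram by (simp add: variety_diagram_def)

text \<open>The congruence corresponding to \<open>Z\<close>. Intersecting with the atoms makes it total in \<open>Z\<close>.\<close>

definition cong_of :: "bowtie \<Rightarrow> nat set \<Rightarrow> ('a \<times> 'a) set" where
  "cong_of p Z = inv_into {\<theta>. congruence ar (Ob p) \<theta>} (\<eta> p) (Z \<inter> atoms p)"

lemma \<eta>_order:
  assumes "congruence ar (Ob p) \<alpha>" "congruence ar (Ob p) \<beta>"
  shows "\<eta> p \<alpha> \<subseteq> \<eta> p \<beta> \<longleftrightarrow> \<alpha> \<subseteq> \<beta>"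
proof -
  obtain g where g: "alg_lat_hom (bowtie_ob p) (Con ar (Ob p)) g"
    "\<And>x. x \<in> carrier (Con ar (Ob p)) \<Longrightarrow> g (\<eta> p x) = x" and h: "alg_lat_hom (Con ar (Ob p)) (bowtie_ob p) (\<eta> p)"
    using iso[of p] by (auto simp: alg_lat_iso_def)
  have c: "\<eta> p \<alpha> \<in> carrier (bowtie_ob p)" "\<eta> p \<beta> \<in> carrier (bowtie_ob p)"
    using h assms by (auto simp: alg_lat_hom_def)
  show ?thesis
    using alg_lat_hom_mono[OF g(1) c] alg_lat_hom_mono[OF h, of \<alpha> \<beta>] assms
    by (auto simp: carrier_ob(2) g(2))
qed

lemma \<eta>_bij: "bij_betw (\<eta> p) {\<theta>. congruence ar (Ob p) \<theta>} (Pow (atoms p))"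
proof -
  obtain g where "alg_lat_hom (bowtie_ob p) (Con ar (Ob p)) g"
    "\<And>x. x \<in> carrier (Con ar (Ob p)) \<Longrightarrow> g (\<eta> p x) = x"
    "\<And>y. y \<in> carrier (bowtie_ob p) \<Longrightarrow> \<eta> p (g y) = y" "alg_lat_hom (Con ar (Ob p)) (bowtie_ob p) (\<eta> p)"
    using iso[of p] by (auto simp: alg_lat_iso_def)
  then show ?thesis
    unfolding carrier_ob(1)[symmetric] by (intro bij_betwI[of _ _ _ g]) (auto simp: alg_lat_hom_def)
qed

lemma congruence_cong_of: "congruence ar (Ob p) (cong_of p Z)"
proof -
  have "Z \<inter> atoms p \<in> \<eta> p ` {\<theta>. congruence ar (Ob p) \<theta>}"
    using \<eta>_bij[of p] by (simp add: bij_betw_def)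
  from inv_into_into[OF this] show ?thesis by (simp add: cong_of_def)
qed

lemma \<eta>_cong_of: "\<eta> p (cong_of p Z) = Z \<inter> atoms p"
proof -
  have "Z \<inter> atoms p \<in> \<eta> p ` {\<theta>. congruence ar (Ob p) \<theta>}"
    using \<eta>_bij[of p] by (simp add: bij_betw_def)
  from f_inv_into_f[OF this] show ?thesis by (simp add: cong_of_def)
qed

lemma le_cong_of: "congruence ar (Ob p) \<alpha> \<Longrightarrow> \<alpha> \<subseteq> cong_of p Z \<longleftrightarrow> \<eta> p \<alpha> \<subseteq> Z"
  using \<eta>_order[OF _ congruence_cong_of, of p \<alpha> Z] \<eta>_bij[of p]
  by (auto simp: \<eta>_cong_of bij_betw_def)

lemma cong_of_le: "congruence ar (Ob p) \<alpha> \<Longrightarrow> cong_of p Z \<subseteq> \<alpha> \<longleftrightarrow> Z \<inter> atoms p \<subseteq> \<eta> p \<alpha>"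
  using \<eta>_order[OF congruence_cong_of, of p \<alpha> Z] by (simp add: \<eta>_cong_of)

lemma cong_of_mono: "Z \<subseteq> Z' \<Longrightarrow> cong_of p Z \<subseteq> cong_of p Z'"
  by (auto simp: le_cong_of[OF congruence_cong_of] \<eta>_cong_of)

lemma cong_of_Int: "cong_of p Z \<inter> cong_of p Z' \<subseteq> cong_of p (Z \<inter> Z')"
proof -
  have c: "congruence ar (Ob p) (cong_of p Z \<inter> cong_of p Z')"
    by (intro congruence_Int congruence_cong_of)
  have "\<eta> p (cong_of p Z \<inter> cong_of p Z') \<subseteq> Z" "\<eta> p (cong_of p Z \<inter> cong_of p Z') \<subseteq> Z'"
    using le_cong_of[OF c, of Z] le_cong_of[OF c, of Z'] by auto
  then show ?thesis using le_cong_of[OF c] by blast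
qed

lemma cong_of_empty: "cong_of p {} \<subseteq> Id"
  using cong_of_le[OF congruence_Id[OF alg], of p "{}"] by (auto simp: Id_on_def)

lemma cong_of_atoms:
  assumes "atoms p \<subseteq> Z"
  shows "cong_of p Z = carrier (Ob p) \<times> carrier (Ob p)"
proof
  have c: "congruence ar (Ob p) (carrier (Ob p) \<times> carrier (Ob p))" by (rule congruence_full[OF alg])
  then have "\<eta> p (carrier (Ob p) \<times> carrier (Ob p)) \<in> Pow (atoms p)"
    by (intro bij_betwE[OF \<eta>_bij, rule_format]) simp
  then show "carrier (Ob p) \<times> carrier (Ob p) \<subseteq> cong_of p Z"
    using le_cong_of[OF c, of Z] assms by blast
qed (rule congruence_sub[OF congruence_cong_of])

text \<open>Restriction along an arrow is the upper adjoint of \<open>Con_map\<close>, so it corresponds to the upper adjoint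
of the arrow of the diagram.\<close>

lemma pull:
  assumes "p \<le> q" "x \<in> carrier (Ob p)" "y \<in> carrier (Ob p)" "(Arr p q x, Arr p q y) \<in> cong_of q Z"
  shows "(x, y) \<in> cong_of p {m \<in> atoms p. bowtie_arr p q {m} \<subseteq> Z}"
proof -
  define \<theta> where "\<theta> = {(x, y). x \<in> carrier (Ob p) \<and> y \<in> carrier (Ob p) \<and> (Arr p q x, Arr p q y) \<in> cong_of q Z}"
  have c: "congruence ar (Ob p) \<theta>"
    unfolding \<theta>_def by (rule congruence_vimage[OF hom[OF assms(1)] alg congruence_cong_of])
  have gen: "{(Arr p q x, Arr p q y) | x y. (x, y) \<in> \<theta>} \<subseteq> cong_of q Z" by (auto simp: \<theta>_def)
  have cm: "congruence ar (Ob q) (Con_map ar (Ob q) (Arr p q) \<theta>)"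
    unfolding Con_map_def using gen congruence_sub[OF congruence_cong_of[of q Z]]
    by (intro congruence_generated[OF alg]) auto
  have "Con_map ar (Ob q) (Arr p q) \<theta> \<subseteq> cong_of q Z"
    unfolding Con_map_def by (rule generated_least[OF congruence_cong_of gen])
  then have le: "bowtie_arr p q (\<eta> p \<theta>) \<subseteq> Z"
    using le_cong_of[OF cm] natural[OF assms(1) c] by simp
  have "\<eta> p \<theta> \<subseteq> atoms p" using \<eta>_bij[of p] c by (auto simp: bij_betw_def)
  moreover have "bowtie_arr p q {m} \<subseteq> Z" if "m \<in> \<eta> p \<theta>" for m
    using bowtie_arr_mono[of "{m}" "\<eta> p \<theta>" p q] that le by auto
  ultimately have "\<theta> \<subseteq> cong_of p {m \<in> atoms p. bowtie_arr p q {m} \<subseteq> Z}"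
    using le_cong_of[OF c] by auto
  then show ?thesis using assms by (auto simp: \<theta>_def)
qed

lemma push:
  assumes "p \<le> q" "(x, y) \<in> cong_of p Z" "bowtie_arr p q Z \<subseteq> Z'"
  shows "(Arr p q x, Arr p q y) \<in> cong_of q Z'"
proof -
  let ?\<alpha> = "cong_of p Z"
  have gen: "{(Arr p q x, Arr p q y) | x y. (x, y) \<in> ?\<alpha>} \<subseteq> carrier (Ob q) \<times> carrier (Ob q)"
    using congruence_sub[OF congruence_cong_of, of p Z] Arr_closed[OF assms(1)] by auto
  have c: "congruence ar (Ob q) (Con_map ar (Ob q) (Arr p q) ?\<alpha>)"
    unfolding Con_map_def by (rule congruence_generated[OF alg gen])
  have "\<eta> q (Con_map ar (Ob q) (Arr p q) ?\<alpha>) \<subseteq> Z'"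
    unfolding natural[OF assms(1) congruence_cong_of] \<eta>_cong_of
    using bowtie_arr_mono[of "Z \<inter> atoms p" Z p q] assms(3) by auto
  then have "Con_map ar (Ob q) (Arr p q) ?\<alpha> \<subseteq> cong_of q Z'" using le_cong_of[OF c] by simp
  moreover have "(Arr p q x, Arr p q y) \<in> Con_map ar (Ob q) (Arr p q) ?\<alpha>"
    unfolding Con_map_def using generated_contains assms(2) by fast
  ultimately show ?thesis by blast
qed

end

subsection \<open>The subalgebra generated by the middle level\<close>

lemma atoms_split: "m < 2 \<longleftrightarrow> m = 0 \<or> m = Suc 0" "m < 3 \<longleftrightarrow> m = 0 \<or> m = Suc 0 \<or> m = (2 :: nat)"
  for m :: nat by auto

text \<open>Here \<open>l\<close> is the index different from \<open>i\<close> and \<open>j\<close>; the image of each of the other two atoms contains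
\<open>i\<close> or \<open>j\<close>.\<close>

lemma u_avoids_two:
  assumes "i \<noteq> j" "i \<noteq> l" "j \<noteq> l"
  shows "{m \<in> {..<3}. bt_u l {m} \<subseteq> ({..<4} - {three_nat i}) \<inter> ({..<4} - {three_nat j})} \<subseteq> {three_nat l}"
  using assms by (cases i; cases j; cases l) (auto simp: from_atoms_def atoms_split)

lemma u_avoids_three: "{m \<in> {..<3}. bt_u l {m} \<subseteq> {0, 1, 2}} \<subseteq> {three_nat l}"
  by (cases l) (auto simp: from_atoms_def atoms_split)

lemma u_three_nat: "bt_u l {three_nat l} = {three_nat l}"
  by (cases l) (auto simp: from_atoms_def)

lemma uf_atoms:
  "bt_u I0 (bt_f i {0}) = (case i of I0 \<Rightarrow> {0, 1, 3} | I1 \<Rightarrow> {0, 1, 3} | I2 \<Rightarrow> {0, 2, 3})"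
  "bt_u I0 (bt_f i {Suc 0}) = (case i of I0 \<Rightarrow> {0, 2, 3} | I1 \<Rightarrow> {1, 2, 3} | I2 \<Rightarrow> {1, 2, 3})"
  by (cases i; auto simp: from_atoms_def)+

lemma uf_avoids:
  assumes "j \<noteq> k" "i \<noteq> j" "i \<noteq> k" "m < 2"
  shows "bt_u I0 (bt_f i {m}) \<subseteq> {..<4} - {three_nat j} \<or> bt_u I0 (bt_f i {m}) \<subseteq> {..<4} - {three_nat k}"
proof -
  have "m = 0 \<or> m = Suc 0" using assms(4) by auto
  then show ?thesis
    using assms(1-3) by (cases i; cases j; cases k) (auto simp: uf_atoms simp del: bt_u.simps bt_f.simps)
qed

lemma uf_same: "m < 2 \<Longrightarrow> \<not> bt_u I0 (bt_f I0 {m}) \<subseteq> {..<4} - {three_nat I0}"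
  by (auto simp: uf_atoms atoms_split simp del: bt_u.simps bt_f.simps)

lemma third_index:
  fixes i j :: three
  obtains l where "l \<noteq> i" "l \<noteq> j"
  by (cases i; cases j) (auto intro: that[of I0] that[of I1] that[of I2])

context bowtie_lifting
begin

abbreviation "top_alg \<equiv> Ob Bt_b"

definition mid :: "three \<Rightarrow> 'a set" where
  "mid i = Arr (Bt_ai i) Bt_b ` carrier (Ob (Bt_ai i))"

definition hull :: "'a set" where
  "hull = \<Inter>{S. S \<subseteq> carrier top_alg \<and> subalgebra ar top_alg S \<and> (\<Union>i. mid i) \<subseteq> S}"

definition coatom :: "three \<Rightarrow> ('a \<times> 'a) set" where
  "coatom k = cong_of Bt_b ({..<4} - {three_nat k})"

text \<open>The three congruences that become the atoms of \<open>M\<^sub>3\<close>.\<close>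

definition hull_cong :: "three \<Rightarrow> ('a \<times> 'a) set" where
  "hull_cong k = coatom k \<inter> hull \<times> hull"

abbreviation "hull_alg \<equiv> top_alg\<lparr>carrier := hull\<rparr>"

lemma le_simps [simp]:
  "Bt_a \<le> q" "p \<le> Bt_b" "Bt_ai i \<le> Bt_bj j"
  by (cases q; simp add: less_eq_bowtie_def) (cases p; simp add: less_eq_bowtie_def)+

lemma hull_le: "S \<subseteq> carrier top_alg \<Longrightarrow> subalgebra ar top_alg S \<Longrightarrow> (\<And>i. mid i \<subseteq> S) \<Longrightarrow> hull \<subseteq> S"
  unfolding hull_def by blast

lemma mid_hull: "mid i \<subseteq> hull"
  unfolding hull_def by blast

lemma mid_top: "mid i \<subseteq> carrier top_alg"
  unfolding mid_def using Arr_closed[of "Bt_ai i" Bt_b] by auto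

lemma hull_top: "hull \<subseteq> carrier top_alg"
  by (rule hull_le) (use alg mid_top in auto)

lemma mid_sub: "subalgebra ar top_alg (mid i)"
  unfolding mid_def by (rule subalgebra_image[OF hom alg]) simp

lemma mid_nonempty: "mid i \<noteq> {}"
  using mid_sub[of i] by (simp add: is_algebra_def)

lemma hull_sub: "subalgebra ar top_alg hull"
  unfolding hull_def
proof (rule subalgebra_Inter)
  show "\<Inter>{S. S \<subseteq> carrier top_alg \<and> subalgebra ar top_alg S \<and> (\<Union>i. mid i) \<subseteq> S} \<noteq> {}"
    using mid_hull[of I0] mid_nonempty[of I0] unfolding hull_def by blast
  show "{S. S \<subseteq> carrier top_alg \<and> subalgebra ar top_alg S \<and> (\<Union>i. mid i) \<subseteq> S} \<noteq> {}"
    using alg[of Bt_b] mid_top by (auto intro!: exI[of _ "carrier top_alg"] simp: is_algebra_def)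
qed blast

lemma hull_in_image: "hull \<subseteq> Arr (Bt_bj l) Bt_b ` carrier (Ob (Bt_bj l))"
proof (rule hull_le)
  show "Arr (Bt_bj l) Bt_b ` carrier (Ob (Bt_bj l)) \<subseteq> carrier top_alg"
    using Arr_closed[of "Bt_bj l" Bt_b] by auto
  show "subalgebra ar top_alg (Arr (Bt_bj l) Bt_b ` carrier (Ob (Bt_bj l)))"
    by (rule subalgebra_image[OF hom alg]) simp
  show "mid i \<subseteq> Arr (Bt_bj l) Bt_b ` carrier (Ob (Bt_bj l))" for i
    unfolding mid_def using Arr_comp[of "Bt_ai i" "Bt_bj l" Bt_b] Arr_closed[of "Bt_ai i" "Bt_bj l"]
    by auto
qed

text \<open>Elements of the hull come from the algebra over \<open>b\<^sub>l\<close>. Pull the congruence back along \<open>u\<^sub>l\<close>, where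
only the atom \<open>l\<close> can survive, and push the result forward.\<close>

lemma shrink:
  assumes "x \<in> hull" "y \<in> hull" "(x, y) \<in> cong_of Bt_b Z"
    and Z: "{m \<in> {..<3}. bt_u l {m} \<subseteq> Z} \<subseteq> {three_nat l}"
  shows "(x, y) \<in> cong_of Bt_b {three_nat l}"
proof -
  obtain x' y' where xy: "x = Arr (Bt_bj l) Bt_b x'" "y = Arr (Bt_bj l) Bt_b y'"
    "x' \<in> carrier (Ob (Bt_bj l))" "y' \<in> carrier (Ob (Bt_bj l))"
    using hull_in_image[of l] assms(1,2) by blast
  have "(x', y') \<in> cong_of (Bt_bj l) {m \<in> {..<3}. bt_u l {m} \<subseteq> Z}"
    using pull[of "Bt_bj l" Bt_b x' y' Z] xy assms(3) by (simp add: numeral_3_eq_3)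
  then have "(x', y') \<in> cong_of (Bt_bj l) {three_nat l}" using cong_of_mono[OF Z] by blast
  then show ?thesis unfolding xy(1,2) by (rule push[rotated]) (simp_all add: u_three_nat)
qed

text \<open>If \<open>l\<close> is the third index, the meet shrinks to \<open>{l}\<close> over \<open>b\<^sub>l\<close>. As this lies in \<open>{0, 1, 2}\<close>, it
also shrinks to \<open>{i}\<close> over \<open>b\<^sub>i\<close>, and \<open>{i}\<close> and \<open>{l}\<close> have empty intersection.\<close>

lemma hull_cong_meet:
  assumes "i \<noteq> j"
  shows "hull_cong i \<inter> hull_cong j \<subseteq> Id"
proof clarify
  fix x y assume xy: "(x, y) \<in> hull_cong i" "(x, y) \<in> hull_cong j"
  obtain l where l: "l \<noteq> i" "l \<noteq> j" by (rule third_index)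
  have h: "x \<in> hull" "y \<in> hull" using xy by (auto simp: hull_cong_def)
  have "(x, y) \<in> cong_of Bt_b (({..<4} - {three_nat i}) \<inter> ({..<4} - {three_nat j}))"
    using xy cong_of_Int by (auto simp: hull_cong_def coatom_def)
  then have l_in: "(x, y) \<in> cong_of Bt_b {three_nat l}"
    by (rule shrink[OF h _ u_avoids_two]) (use assms l in auto)
  moreover have "{three_nat l} \<subseteq> {0, 1, 2}" by (cases l) auto
  ultimately have "(x, y) \<in> cong_of Bt_b {0, 1, 2}" using cong_of_mono by blast
  then have "(x, y) \<in> cong_of Bt_b {three_nat i}" by (rule shrink[OF h _ u_avoids_three])
  then have "(x, y) \<in> cong_of Bt_b ({three_nat i} \<inter> {three_nat l})" using l_in cong_of_Int by blast
  moreover have "{three_nat i} \<inter> {three_nat l} = {}" using l(1) by (cases i; cases l) auto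
  ultimately show "x = y" using cong_of_empty[of Bt_b] by auto
qed

text \<open>The full congruence of \<open>A\<^sub>i\<close> is the join of two atoms, and \<open>Con_map\<close> sends each atom into one of the
two coatoms. The chain is kept inside \<open>A\<^sub>i\<close>, since
\<open>proj_not_cancellable\<close> can only move between elements of the subalgebra.\<close>

lemma mid_join:
  assumes "j \<noteq> k" "i \<noteq> j" "i \<noteq> k"
  shows "mid i \<times> mid i \<subseteq> ((hull_cong j \<union> hull_cong k) \<inter> mid i \<times> mid i)\<^sup>*"
proof clarify
  fix a b assume "a \<in> mid i" "b \<in> mid i"
  then obtain x y where xy: "a = Arr (Bt_ai i) Bt_b x" "b = Arr (Bt_ai i) Bt_b y"
    "x \<in> carrier (Ob (Bt_ai i))" "y \<in> carrier (Ob (Bt_ai i))"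
    by (auto simp: mid_def)
  let ?A = "Ob (Bt_ai i)" and ?c = "cong_of (Bt_ai i)"
  have c: "congruence ar ?A ((?c {0} \<union> ?c {1})\<^sup>+)"
    by (intro congruence_join[OF alg] congruence_cong_of)
  have "?c {0} \<subseteq> (?c {0} \<union> ?c {1})\<^sup>+" "?c {1} \<subseteq> (?c {0} \<union> ?c {1})\<^sup>+" by auto
  then have "atoms (Bt_ai i) \<subseteq> \<eta> (Bt_ai i) ((?c {0} \<union> ?c {1})\<^sup>+)"
    unfolding cong_of_le[OF c] by (auto simp: less_Suc_eq)
  then have "?c (atoms (Bt_ai i)) \<subseteq> (?c {0} \<union> ?c {1})\<^sup>+" unfolding cong_of_le[OF c] by simp
  then have "(x, y) \<in> (?c {0} \<union> ?c {1})\<^sup>+" using xy cong_of_atoms[of "Bt_ai i"] by blast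
  then show "(a, b) \<in> ((hull_cong j \<union> hull_cong k) \<inter> mid i \<times> mid i)\<^sup>*"
    unfolding xy(1,2)
  proof (induction rule: trancl_induct)
    have step: "(Arr (Bt_ai i) Bt_b u, Arr (Bt_ai i) Bt_b w) \<in> (hull_cong j \<union> hull_cong k) \<inter> mid i \<times> mid i"
      if uw: "(u, w) \<in> ?c {0} \<union> ?c {1}" for u w
    proof -
      obtain m :: nat where m: "m < 2" "(u, w) \<in> ?c {m}" using uw by (auto intro: that[of 0] that[of 1])
      have "u \<in> carrier ?A" "w \<in> carrier ?A" using m(2) congruence_sub[OF congruence_cong_of] by blast+
      then have "Arr (Bt_ai i) Bt_b u \<in> mid i" "Arr (Bt_ai i) Bt_b w \<in> mid i" by (auto simp: mid_def)
      moreover have "(Arr (Bt_ai i) Bt_b u, Arr (Bt_ai i) Bt_b w) \<in> coatom j \<union> coatom k"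
        using uf_avoids[OF assms m(1)] push[OF _ m(2), of Bt_b]
        by (auto simp: coatom_def simp del: bt_u.simps bt_f.simps)
      ultimately show ?thesis using mid_hull[of i] by (auto simp: hull_cong_def)
    qed
    show "(Arr (Bt_ai i) Bt_b x, Arr (Bt_ai i) Bt_b w) \<in> ((hull_cong j \<union> hull_cong k) \<inter> mid i \<times> mid i)\<^sup>*"
      if "(x, w) \<in> ?c {0} \<union> ?c {1}" for w
      using step[OF that] by blast
    show "(Arr (Bt_ai i) Bt_b x, Arr (Bt_ai i) Bt_b w) \<in> ((hull_cong j \<union> hull_cong k) \<inter> mid i \<times> mid i)\<^sup>*"
      if "(u, w) \<in> ?c {0} \<union> ?c {1}"
        "(Arr (Bt_ai i) Bt_b x, Arr (Bt_ai i) Bt_b u) \<in> ((hull_cong j \<union> hull_cong k) \<inter> mid i \<times> mid i)\<^sup>*" for u w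
      using that(2) step[OF that(1)] by (rule rtrancl_into_rtrancl)
  qed
qed

definition base :: "'a set" where
  "base = Arr Bt_a Bt_b ` carrier (Ob Bt_a)"

lemma base_mid: "base \<subseteq> mid i"
  unfolding base_def mid_def
  using Arr_comp[of Bt_a "Bt_ai i" Bt_b] Arr_closed[of Bt_a "Bt_ai i"] by auto

lemma base_nontrivial: "\<exists>x \<in> base. \<exists>y \<in> base. x \<noteq> y"
proof -
  have "\<not> cong_of Bt_a {0} \<subseteq> cong_of Bt_a {}"
    using cong_of_le[OF congruence_cong_of, of Bt_a "{0}" "{}"] by (simp add: \<eta>_cong_of)
  then obtain x y where xy: "(x, y) \<in> cong_of Bt_a {0}" "(x, y) \<notin> cong_of Bt_a {}" by auto
  then have C: "x \<in> carrier (Ob Bt_a)" "y \<in> carrier (Ob Bt_a)"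
    using congruence_sub[OF congruence_cong_of] by blast+
  have "Arr Bt_a Bt_b x \<noteq> Arr Bt_a Bt_b y"
  proof
    assume "Arr Bt_a Bt_b x = Arr Bt_a Bt_b y"
    then have "(Arr Bt_a Bt_b x, Arr Bt_a Bt_b y) \<in> cong_of Bt_b {}"
      using congruence_refl[OF congruence_cong_of] Arr_closed[of Bt_a Bt_b] C by auto
    then have h: "(x, y) \<in> cong_of Bt_a {m \<in> atoms Bt_a. bowtie_arr Bt_a Bt_b {m} \<subseteq> {}}"
      using C by (intro pull) auto
    have e: "{m \<in> atoms Bt_a. bowtie_arr Bt_a Bt_b {m} \<subseteq> {}} = {}"
      by (auto simp: from_atoms_def bt_e_def)
    show False using h xy(2) unfolding e by simp
  qed
  then show ?thesis using C by (auto simp: base_def)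
qed

text \<open>\<open>\<Theta>\<close> identifies the elements of the image of the algebra over \<open>a\<close>. Since \<open>e\<close> sends the atom of \<open>\<PP>(1)\<close> to the top of \<open>\<PP>(2)\<close>, this
forces \<open>\<Theta>\<close> to be full on every \<open>A\<^sub>m\<close>. A class of \<open>\<Theta>\<close> that contains a subalgebra is itself closed under the
operations, so the class containing all \<open>A\<^sub>m\<close> is the whole hull.\<close>

lemma hull_generates:
  assumes \<Theta>: "congruence ar hull_alg \<Theta>" and i: "mid i \<times> mid i \<subseteq> \<Theta>"
  shows "\<Theta> = hull \<times> hull"
proof
  have hom_mid: "algebra_hom ar (Ob (Bt_ai m)) hull_alg (Arr (Bt_ai m) Bt_b)" for m
    using hom[of "Bt_ai m" Bt_b] mid_hull[of m] by (auto simp: algebra_hom_def mid_def)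
  have mid_\<Theta>: "mid m \<times> mid m \<subseteq> \<Theta>" for m
  proof -
    let ?A = "Ob (Bt_ai m)"
    define \<theta> where "\<theta> = {(x, y). x \<in> carrier ?A \<and> y \<in> carrier ?A \<and>
       (Arr (Bt_ai m) Bt_b x, Arr (Bt_ai m) Bt_b y) \<in> \<Theta>}"
    have c: "congruence ar ?A \<theta>" unfolding \<theta>_def by (rule congruence_vimage[OF hom_mid alg \<Theta>])
    let ?full = "carrier (Ob Bt_a) \<times> carrier (Ob Bt_a)"
    have full: "congruence ar (Ob Bt_a) ?full" by (rule congruence_full[OF alg])
    have "{(Arr Bt_a (Bt_ai m) x, Arr Bt_a (Bt_ai m) y) | x y. (x, y) \<in> ?full} \<subseteq> \<theta>"
    proof clarify
      fix x y assume xy: "x \<in> carrier (Ob Bt_a)" "y \<in> carrier (Ob Bt_a)"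
      then have "(Arr Bt_a Bt_b x, Arr Bt_a Bt_b y) \<in> \<Theta>"
        using i base_mid[of i] by (auto simp: base_def)
      then show "(Arr Bt_a (Bt_ai m) x, Arr Bt_a (Bt_ai m) y) \<in> \<theta>"
        using xy Arr_comp[of Bt_a "Bt_ai m" Bt_b] Arr_closed[of Bt_a "Bt_ai m"] by (simp add: \<theta>_def)
    qed
    then have le: "Con_map ar ?A (Arr Bt_a (Bt_ai m)) ?full \<subseteq> \<theta>"
      unfolding Con_map_def by (rule generated_least[OF c])
    have cm: "congruence ar ?A (Con_map ar ?A (Arr Bt_a (Bt_ai m)) ?full)"
      unfolding Con_map_def using Arr_closed[of Bt_a "Bt_ai m"]
      by (intro congruence_generated[OF alg]) auto
    have "\<eta> Bt_a ?full = {0}"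
      using \<eta>_cong_of[of Bt_a "atoms Bt_a"] cong_of_atoms[of Bt_a "atoms Bt_a"] by auto
    then have "\<eta> (Bt_ai m) (Con_map ar ?A (Arr Bt_a (Bt_ai m)) ?full) = {0, 1}"
      using natural[OF _ full, of "Bt_ai m"] by (simp add: bt_e_def from_atoms_def)
    then have "cong_of (Bt_ai m) (atoms (Bt_ai m)) \<subseteq> Con_map ar ?A (Arr Bt_a (Bt_ai m)) ?full"
      unfolding cong_of_le[OF cm] by (simp add: lessThan_Suc)
    then have "carrier ?A \<times> carrier ?A \<subseteq> \<theta>" using le cong_of_atoms[of "Bt_ai m"] by blast
    then show ?thesis by (auto simp: \<theta>_def mid_def)
  qed
  obtain o' where o': "o' \<in> base" using base_nontrivial by blast
  let ?S = "{x \<in> hull. (o', x) \<in> \<Theta>}"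
  have o_mid: "o' \<in> mid m" for m using o' base_mid by blast
  have "hull \<subseteq> ?S"
  proof (rule hull_le)
    show "?S \<subseteq> carrier top_alg" using hull_top by auto
    show "mid m \<subseteq> ?S" for m using mid_\<Theta>[of m] o_mid[of m] mid_hull[of m] by auto
    have "opn top_alg f xs \<in> ?S" if xs: "length xs = ar f" "set xs \<subseteq> ?S" for f xs
    proof -
      let ?os = "replicate (ar f) o'"
      have "opn top_alg f ?os \<in> mid I0"
        using opn_closed[OF mid_sub[of I0], of ?os f] o_mid[of I0] by (simp add: set_replicate_conv_if)
      then have "(o', opn top_alg f ?os) \<in> \<Theta>" using mid_\<Theta>[of I0] o_mid[of I0] by blast
      moreover have "(opn hull_alg f ?os, opn hull_alg f xs) \<in> \<Theta>"
      proof (rule opn_cong[OF \<Theta>])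
        have "(o', xs ! n) \<in> \<Theta>" if "n < length xs" for n
          using xs(2) nth_mem[OF that] by blast
        then show "list_all2 (\<lambda>x y. (x, y) \<in> \<Theta>) ?os xs"
          using xs(1) by (simp add: list_all2_conv_all_nth)
      qed simp
      moreover have "opn hull_alg f xs \<in> hull"
        using opn_closed[OF hull_sub, of xs f] xs by auto
      ultimately show ?thesis using congruence_trans[OF \<Theta>] by auto
    qed
    moreover have "o' \<in> ?S" using o_mid[of I0] mid_\<Theta>[of I0] mid_hull[of I0] by auto
    ultimately show "subalgebra ar top_alg ?S" unfolding is_algebra_def by auto
  qed
  then show "hull \<times> hull \<subseteq> \<Theta>"
    using congruence_sym[OF \<Theta>] congruence_trans[OF \<Theta>] by blast
  show "\<Theta> \<subseteq> hull \<times> hull" using congruence_sub[OF \<Theta>] by simp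
qed

lemma congruence_hull_cong: "congruence ar hull_alg (hull_cong k)"
  unfolding hull_cong_def coatom_def
  by (rule congruence_restrict[OF congruence_cong_of hull_sub hull_top])

lemma hull_cong_join:
  assumes "j \<noteq> k"
  shows "hull \<times> hull \<subseteq> (hull_cong j \<union> hull_cong k)\<^sup>*"
proof -
  obtain i where i: "i \<noteq> j" "i \<noteq> k" by (rule third_index)
  have c: "congruence ar hull_alg ((hull_cong j \<union> hull_cong k)\<^sup>+)"
    by (rule congruence_join[OF hull_sub congruence_hull_cong congruence_hull_cong])
  have "mid i \<times> mid i \<subseteq> (hull_cong j \<union> hull_cong k)\<^sup>+"
  proof clarify
    fix x y assume xy: "x \<in> mid i" "y \<in> mid i"
    then have "(x, y) \<in> ((hull_cong j \<union> hull_cong k) \<inter> mid i \<times> mid i)\<^sup>*"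
      using mid_join[OF assms i] by blast
    then have "(x, y) \<in> (hull_cong j \<union> hull_cong k)\<^sup>*" by (rule rtrancl_mono[THEN subsetD, rotated]) blast
    then show "(x, y) \<in> (hull_cong j \<union> hull_cong k)\<^sup>+"
      using congruence_refl[OF c, of x] xy mid_hull[of i] by (auto simp: rtrancl_eq_or_trancl)
  qed
  then have "(hull_cong j \<union> hull_cong k)\<^sup>+ = hull \<times> hull" by (rule hull_generates[OF c])
  then show ?thesis by (metis trancl_into_rtrancl subrelI)
qed

text \<open>The coatom missing \<open>0\<close> restricts to the trivial congruence on \<open>A\<^sub>0\<close>, because both atoms of \<open>Con A\<^sub>0\<close> are
sent to sets containing \<open>0\<close>. On the hull it is not trivial, as the joins would otherwise make the other two
congruences full.\<close>

lemma mid_proper: "mid I0 \<noteq> hull"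
proof
  assume eq: "mid I0 = hull"
  have "hull_cong I0 \<subseteq> Id"
  proof clarify
    fix a b assume ab: "(a, b) \<in> hull_cong I0"
    then obtain x y where xy: "a = Arr (Bt_ai I0) Bt_b x" "b = Arr (Bt_ai I0) Bt_b y"
      "x \<in> carrier (Ob (Bt_ai I0))" "y \<in> carrier (Ob (Bt_ai I0))"
      unfolding hull_cong_def eq[symmetric] mid_def by blast
    have "(Arr (Bt_ai I0) Bt_b x, Arr (Bt_ai I0) Bt_b y) \<in> cong_of Bt_b ({..<4} - {three_nat I0})"
      using ab xy(1,2) by (simp add: hull_cong_def coatom_def)
    then have h: "(x, y) \<in> cong_of (Bt_ai I0)
        {m \<in> atoms (Bt_ai I0). bowtie_arr (Bt_ai I0) Bt_b {m} \<subseteq> {..<4} - {three_nat I0}}"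
      using xy(3,4) by (intro pull) auto
    have e: "{m \<in> atoms (Bt_ai I0). bowtie_arr (Bt_ai I0) Bt_b {m} \<subseteq> {..<4} - {three_nat I0}} = {}"
      using uf_same by (auto simp del: bt_u.simps bt_f.simps three_nat.simps)
    show "a = b" using h cong_of_empty[of "Bt_ai I0"] xy(1,2) unfolding e by auto
  qed
  then have "hull \<times> hull \<subseteq> hull_cong k" if "k \<noteq> I0" for k
  proof -
    have "(x, y) \<in> hull_cong k" if "(x, y) \<in> (hull_cong I0 \<union> hull_cong k)\<^sup>*" "x \<in> hull" for x y
      using that
    proof induction
      case base
      then show ?case using congruence_refl[OF congruence_hull_cong] by simp
    next
      case (step y z)
      then show ?case
        using \<open>hull_cong I0 \<subseteq> Id\<close> congruence_trans[OF congruence_hull_cong[of k], of x y z] by auto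
    qed
    then show ?thesis using hull_cong_join[of I0 k] that by blast
  qed
  then have "hull \<times> hull \<subseteq> Id" using hull_cong_meet[of I1 I2] by blast
  then show False using base_nontrivial base_mid[of I0] mid_hull[of I0] by blast
qed

lemma hull_m3_algebra: "m3_algebra ar hull_alg hull_cong (mid I0)"
proof
  show "equiv (carrier hull_alg) (hull_cong k)" for k
    by (rule congruence_equiv[OF congruence_hull_cong])
  show "hull_cong i \<inter> hull_cong j \<subseteq> Id" if "i \<noteq> j" for i j by (rule hull_cong_meet[OF that])
  show "carrier hull_alg \<times> carrier hull_alg \<subseteq> (hull_cong i \<union> hull_cong j)\<^sup>*" if "i \<noteq> j" for i j
    using hull_cong_join[OF that] by simp
  show "subalgebra ar hull_alg (mid I0)" using mid_sub[of I0] by simp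
  show "mid I0 \<times> mid I0 \<subseteq> ((\<Union>k. hull_cong k) \<inter> mid I0 \<times> mid I0)\<^sup>*"
    by (rule order_trans[OF mid_join[of I1 I2 I0] rtrancl_mono]) auto
qed (use mid_hull hull_sub congruence_hull_cong hull_generates mid_proper in auto)

end

theorem theorem4p1:
  fixes ar :: "'f \<Rightarrow> nat"
    and E :: "(('f, nat) tm \<times> ('f, nat) tm) set"
  assumes "E \<subseteq> identities ar"
    and "\<exists>(Ob :: bowtie \<Rightarrow> ('f, 'a) algebra) (Arr :: bowtie \<Rightarrow> bowtie \<Rightarrow> 'a \<Rightarrow> 'a).
           is_lifting ar E Ob Arr bowtie_ob bowtie_arr"
  shows "(\<exists>U :: ('f, 'a) algebra. U \<in> in_variety ar E \<and>
            (\<exists>h. zero_one_lattice_embedding M3 (Con ar U) h)) \<and>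
         (\<forall>p q. congruence_identity_of ar E p q \<longrightarrow>
            (\<forall>L :: 'l gorder. lattice L \<longrightarrow> lattice_identity_holds L p q))"
proof -
  obtain Ob :: "bowtie \<Rightarrow> ('f, 'a) algebra" and Arr \<eta> where "bowtie_lifting ar E Ob Arr \<eta>"
    using assms(2) unfolding is_lifting_def con_naturally_equivalent_def bowtie_lifting_def by auto
  then interpret bowtie_lifting ar E Ob Arr \<eta> .
  interpret M: m3_algebra ar hull_alg hull_cong "mid I0" by (rule hull_m3_algebra)
  have V: "hull_alg \<in> in_variety ar E"
    by (rule in_variety_subalgebra[OF in_V hull_sub hull_top])
  show ?thesis
    using V M.M3_embeds M.congruence_identity_trivial[OF V assms(1)] by blast
qed

end
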